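(* Let $q>1$, let $\mathfrak{G}_\Gamma$ be a finite $(q+1)$-regular graph, let $f\in C^{\mathrm{lc}}(\mathfrak{P}_\Gamma)$, and let $f_+\in C^{\mathrm{lc}}(\mathfrak{P}_\Gamma^+)$ be a one-sided reduction of $f$ (i.e. $f\circ\sigma^{m_0}=f_+\circ\pi_+$ for some $m_0\ge1$), having depth at most $m$ (i.e. $f_+\in F_m(\mathfrak{P}_\Gamma^+)$), for $m$ sufficiently large. For $\beta\in\mathbb{C}$ let $\omega_\beta(\mathbf{p})=e^{-\beta f_+(\mathbf{p})}$, $\mathbf{p}\in\mathfrak{P}_\Gamma^+$, and let $\mathcal{L}_{\beta,F_m}=\mathcal{L}_{\Gamma,+,\omega_\beta}|_{F_m(\mathfrak{P}_\Gamma^+)}$ be the corresponding weighted transfer operator restricted to the finite-dimensional space $F_m(\mathfrak{P}_\Gamma^+)$. Then, for $\mathrm{Im}(s)>\frac32+\frac{|\beta|\,\|f_+\|_\infty}{\log q}$, $$d_f(s,\beta)=\det\big(\mathrm{Id}-q^{\frac12+is}\mathcal{L}_{\beta,F_m}\big),$$ where the determinant is the ordinary finite-dimensional determinant. In particular, the dynamical determinant $d_f(s,\beta)$ continues to a holomorphic function of $(s,\beta)\in\mathbb{C}^2$.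
   Context: $\mathfrak{G}_\Gamma$ is a finite connected simple $(q+1)$-regular graph with directed edges closed under reversal; $\iota,\tau$ denote initial/terminal vertex and $\vec e^{\,\mathrm{op}}$ the reversed edge. A sequence of edges is admissible if consecutive edges $\vec a,\vec b$ satisfy $\tau(\vec a)=\iota(\vec b)$, $\vec b\ne\vec a^{\,\mathrm{op}}$. $\mathfrak{P}_\Gamma^+$: admissible right-infinite sequences $(\vec e_1,\vec e_2,\ldots)$, shift $\sigma_+$ dropping $\vec e_1$; $\mathfrak{P}_\Gamma^-$: admissible left-infinite sequences $(\ldots,\vec e_2,\vec e_1)$. $\mathfrak{P}_\Gamma\subset\mathfrak{P}_\Gamma^+\times\mathfrak{P}_\Gamma^-$: pairs $((\vec e_1,\ldots),(\ldots,\vec b_1))$ with $\iota(\vec e_1)=\tau(\vec b_1)$, $\vec e_1\ne\vec b_1^{\,\mathrm{op}}$, with shift $\sigma((\vec e_1,\vec e_2,\ldots),(\ldots,\vec b_1))=((\vec e_2,\ldots),(\ldots,\vec b_1,\vec e_1))$; $\pi_+:\mathfrak{P}_\Gamma\to\mathfrak{P}_\Gamma^+$ is the projection. $C^{\mathrm{lc}}$: locally constant complex functions. $F_m(\mathfrak{P}_\Gamma^+)$: functions depending only on the first $m$ edges; it is invariant under $\mathcal{L}_{\Gamma,+,\omega}$ when $\omega\in F_m$, where $(\mathcal{L}_{\Gamma,+,\omega}\varphi)(\mathbf{p})=\sum_{\sigma_+(\mathbf{p}')=\mathbf{p}}\omega(\mathbf{p}')\varphi(\mathbf{p}')$. A closed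 path of length $n\ge3$ is an admissible $(\vec e_1,\ldots,\vec e_n)$ with $\tau(\vec e_n)=\iota(\vec e_1)$, $\vec e_1\ne\vec e_n^{\,\mathrm{op}}$; primitive means not a repetition of a shorter closed path; $\mathscr{P}_0$ is the set of primitive closed paths modulo cyclic rotation, $\ell_0$ the length of $[\mathbf{p}_0]$, $\widehat{\mathbf{p}}_0\in\mathfrak{P}_\Gamma$ the bi-infinite periodic repetition of a representative, $\mathbf{f}_{\ell_0}(\widehat{\mathbf{p}}_0)=\sum_{k=0}^{\ell_0-1}f(\sigma^k(\widehat{\mathbf{p}}_0))$. On the domain of absolute convergence the dynamical determinant is $$d_f(s,\beta)=\exp\Big(-\sum_{k=1}^\infty\sum_{[\mathbf{p}_0]\in\mathscr{P}_0}\frac{q^{(\frac12+is)k\ell_0}}{k}e^{-k\beta\,\mathbf{f}_{\ell_0}(\widehat{\mathbf{p}}_0)}\Big).$$ *)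

theory Defs
  imports
    "HOL-Analysis.Analysis"
    "HOL-Library.Function_Algebras"
    "Graph_Theory.Graph_Theory"
    "Jordan_Normal_Form.Determinant"
begin

section \<open>Admissible edge sequences on a graph\<close>

text \<open>
  A finite simple graph is a \<^locale>\<open>pair_graph\<close>: directed edges are pairs of vertices, the edge set
  is closed under reversal, \<open>fst\<close> and \<open>snd\<close> are the initial and the terminal vertex, and
  \<open>prod.swap\<close> reverses an edge.
\<close>

type_synonym 'v edge = "'v \<times> 'v"

definition regular_graph :: "nat \<Rightarrow> 'v pair_pre_digraph \<Rightarrow> bool" where
  "regular_graph d G \<longleftrightarrow> (\<forall>v \<in> pverts G. out_degree (with_proj G) v = d)"

definition admissible_pair :: "'v edge \<Rightarrow> 'v edge \<Rightarrow> bool" where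
  "admissible_pair a b \<longleftrightarrow> snd a = fst b \<and> b \<noteq> prod.swap a"

text \<open>
  Both kinds of one-sided sequences are functions on \<open>nat\<close>; index \<open>i\<close> holds the edge numbered
  \<open>i + 1\<close>. A left-infinite sequence \<open>(\<dots>, b\<^sub>2, b\<^sub>1)\<close> is thus stored reading away from its right end.
\<close>

definition paths_plus :: "'v pair_pre_digraph \<Rightarrow> (nat \<Rightarrow> 'v edge) set" where
  "paths_plus G = {e. \<forall>i. e i \<in> parcs G \<and> admissible_pair (e i) (e (Suc i))}"

definition paths_minus :: "'v pair_pre_digraph \<Rightarrow> (nat \<Rightarrow> 'v edge) set" where
  "paths_minus G = {b. \<forall>i. b i \<in> parcs G \<and> admissible_pair (b (Suc i)) (b i)}"

definition paths :: "'v pair_pre_digraph \<Rightarrow> ((nat \<Rightarrow> 'v edge) \<times> (nat \<Rightarrow> 'v edge)) set" where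
  "paths G = {(e, b). e \<in> paths_plus G \<and> b \<in> paths_minus G \<and> admissible_pair (b 0) (e 0)}"

definition shift_plus :: "(nat \<Rightarrow> 'v edge) \<Rightarrow> nat \<Rightarrow> 'v edge" where
  "shift_plus e = (\<lambda>i. e (Suc i))"

definition shift ::
  "(nat \<Rightarrow> 'v edge) \<times> (nat \<Rightarrow> 'v edge) \<Rightarrow> (nat \<Rightarrow> 'v edge) \<times> (nat \<Rightarrow> 'v edge)" where
  "shift = (\<lambda>(e, b). (shift_plus e, case_nat (e 0) b))"


section \<open>Locally constant functions\<close>

text \<open>
  Functions on a path space are total functions of which only the values on that space matter.
\<close>

definition edge_seq_topology :: "'v pair_pre_digraph \<Rightarrow> (nat \<Rightarrow> 'v edge) topology" where
  "edge_seq_topology G = product_topology (\<lambda>_. discrete_topology (parcs G)) UNIV"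

definition paths_plus_topology :: "'v pair_pre_digraph \<Rightarrow> (nat \<Rightarrow> 'v edge) topology" where
  "paths_plus_topology G = subtopology (edge_seq_topology G) (paths_plus G)"

definition paths_topology ::
  "'v pair_pre_digraph \<Rightarrow> ((nat \<Rightarrow> 'v edge) \<times> (nat \<Rightarrow> 'v edge)) topology" where
  "paths_topology G =
     subtopology (prod_topology (edge_seq_topology G) (edge_seq_topology G)) (paths G)"

definition locally_constant :: "'x topology \<Rightarrow> ('x \<Rightarrow> 'y) \<Rightarrow> bool" where
  "locally_constant X f \<longleftrightarrow>
     (\<forall>x \<in> topspace X. \<exists>U. openin X U \<and> x \<in> U \<and> (\<forall>y \<in> U. f y = f x))"

definition depth_at_most ::
  "'v pair_pre_digraph \<Rightarrow> nat \<Rightarrow> ((nat \<Rightarrow> 'v edge) \<Rightarrow> complex) \<Rightarrow> bool" where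
  "depth_at_most G m \<phi> \<longleftrightarrow>
     (\<forall>p \<in> paths_plus G. \<forall>p' \<in> paths_plus G. (\<forall>i<m. p i = p' i) \<longrightarrow> \<phi> p = \<phi> p')"

text \<open>
  As a vector space, \<open>F\<^sub>m\<close> needs one representative per function on the path space: the one
  vanishing off the path space.
\<close>

definition F_space ::
  "'v pair_pre_digraph \<Rightarrow> nat \<Rightarrow> ((nat \<Rightarrow> 'v edge) \<Rightarrow> complex) set" where
  "F_space G m = {\<phi>. depth_at_most G m \<phi> \<and> (\<forall>p. p \<notin> paths_plus G \<longrightarrow> \<phi> p = 0)}"

definition one_sided_reduction ::
  "'v pair_pre_digraph \<Rightarrow> ((nat \<Rightarrow> 'v edge) \<times> (nat \<Rightarrow> 'v edge) \<Rightarrow> complex) \<Rightarrow>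
     ((nat \<Rightarrow> 'v edge) \<Rightarrow> complex) \<Rightarrow> bool" where
  "one_sided_reduction G f f_plus \<longleftrightarrow>
     (\<exists>m\<^sub>0\<ge>1. \<forall>p \<in> paths G. f ((shift ^^ m\<^sub>0) p) = f_plus (fst p))"

definition sup_norm_plus ::
  "'v pair_pre_digraph \<Rightarrow> ((nat \<Rightarrow> 'v edge) \<Rightarrow> complex) \<Rightarrow> real" where
  "sup_norm_plus G \<phi> = (SUP p \<in> paths_plus G. norm (\<phi> p))"


section \<open>Transfer operators and finite-dimensional determinants\<close>

definition transfer_op ::
  "'v pair_pre_digraph \<Rightarrow> ((nat \<Rightarrow> 'v edge) \<Rightarrow> complex) \<Rightarrow>
     ((nat \<Rightarrow> 'v edge) \<Rightarrow> complex) \<Rightarrow> (nat \<Rightarrow> 'v edge) \<Rightarrow> complex" where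
  "transfer_op G \<omega> \<phi> =
     (\<lambda>p. if p \<in> paths_plus G
          then \<Sum>p' \<in> {p' \<in> paths_plus G. shift_plus p' = p}. \<omega> p' * \<phi> p' else 0)"

definition fun_scale :: "complex \<Rightarrow> ('x \<Rightarrow> complex) \<Rightarrow> 'x \<Rightarrow> complex" where
  "fun_scale c \<phi> = (\<lambda>x. c * \<phi> x)"

global_interpretation fun_vs: vector_space fun_scale
  by unfold_locales (auto simp: fun_scale_def fun_eq_iff algebra_simps)

text \<open>
  The determinant of a linear operator \<open>T\<close> on a finite-dimensional space \<open>V\<close> of complex functions:
  the determinant of its matrix in some ordered basis of \<open>V\<close>. Other bases give similar matrices.
\<close>

definition ordered_basis :: "('x \<Rightarrow> complex) set \<Rightarrow> ('x \<Rightarrow> complex) list \<Rightarrow> bool" where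
  "ordered_basis V bs \<longleftrightarrow>
     distinct bs \<and> fun_vs.independent (set bs) \<and> fun_vs.span (set bs) = V"

definition op_matrix ::
  "('x \<Rightarrow> complex) list \<Rightarrow> (('x \<Rightarrow> complex) \<Rightarrow> 'x \<Rightarrow> complex) \<Rightarrow> complex Matrix.mat" where
  "op_matrix bs T =
     Matrix.mat (length bs) (length bs)
       (\<lambda>(i, j). fun_vs.representation (set bs) (T (bs ! j)) (bs ! i))"

definition op_det ::
  "('x \<Rightarrow> complex) set \<Rightarrow> (('x \<Rightarrow> complex) \<Rightarrow> 'x \<Rightarrow> complex) \<Rightarrow> complex" where
  "op_det V T = Determinant.det (op_matrix (SOME bs. ordered_basis V bs) T)"


section \<open>Closed paths and the dynamical determinant\<close>

definition closed_path :: "'v pair_pre_digraph \<Rightarrow> 'v edge list \<Rightarrow> bool" where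
  "closed_path G c \<longleftrightarrow>
     length c \<ge> 3 \<and> set c \<subseteq> parcs G \<and> successively admissible_pair c \<and>
     admissible_pair (last c) (hd c)"

definition primitive_path :: "'v pair_pre_digraph \<Rightarrow> 'v edge list \<Rightarrow> bool" where
  "primitive_path G c \<longleftrightarrow>
     closed_path G c \<and>
     \<not> (\<exists>d k. closed_path G d \<and> length d < length c \<and> c = concat (replicate k d))"

definition primitive_classes :: "'v pair_pre_digraph \<Rightarrow> 'v edge list set set" where
  "primitive_classes G =
     {c. primitive_path G c} // {(c, d). primitive_path G c \<and> (\<exists>n. d = rotate n c)}"

definition class_rep :: "'v edge list set \<Rightarrow> 'v edge list" where
  "class_rep C = (SOME c. c \<in> C)"

definition class_length :: "'v edge list set \<Rightarrow> nat" where
  "class_length C = length (class_rep C)"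

definition periodic_path ::
  "'v edge list \<Rightarrow> (nat \<Rightarrow> 'v edge) \<times> (nat \<Rightarrow> 'v edge)" where
  "periodic_path c =
     (\<lambda>i. c ! (i mod length c), \<lambda>i. rev c ! (i mod length c))"

definition birkhoff_sum ::
  "((nat \<Rightarrow> 'v edge) \<times> (nat \<Rightarrow> 'v edge) \<Rightarrow> complex) \<Rightarrow> nat \<Rightarrow>
     (nat \<Rightarrow> 'v edge) \<times> (nat \<Rightarrow> 'v edge) \<Rightarrow> complex" where
  "birkhoff_sum f n p = (\<Sum>k<n. f ((shift ^^ k) p))"

definition dyn_term ::
  "nat \<Rightarrow> ((nat \<Rightarrow> 'v edge) \<times> (nat \<Rightarrow> 'v edge) \<Rightarrow> complex) \<Rightarrow> complex \<Rightarrow> complex \<Rightarrow>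
     nat \<Rightarrow> 'v edge list set \<Rightarrow> complex" where
  "dyn_term q f s \<beta> k C =
     of_nat q powr ((1/2 + \<i> * s) * of_nat k * of_nat (class_length C)) / of_nat k *
     exp (- of_nat k * \<beta> * birkhoff_sum f (class_length C) (periodic_path (class_rep C)))"

definition abs_conv_domain ::
  "'v pair_pre_digraph \<Rightarrow> nat \<Rightarrow>
     ((nat \<Rightarrow> 'v edge) \<times> (nat \<Rightarrow> 'v edge) \<Rightarrow> complex) \<Rightarrow> (complex \<times> complex) set" where
  "abs_conv_domain G q f =
     {(s, \<beta>). (\<lambda>(k, C). norm (dyn_term q f s \<beta> k C)) summable_on ({1..} \<times> primitive_classes G)}"

text \<open>Only meaningful on \<^const>\<open>abs_conv_domain\<close>; elsewhere \<open>infsum\<close> may take its default value.\<close>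

definition dyn_det ::
  "'v pair_pre_digraph \<Rightarrow> nat \<Rightarrow>
     ((nat \<Rightarrow> 'v edge) \<times> (nat \<Rightarrow> 'v edge) \<Rightarrow> complex) \<Rightarrow> complex \<Rightarrow> complex \<Rightarrow> complex" where
  "dyn_det G q f s \<beta> =
     exp (- (\<Sum>\<^sub>\<infinity>k\<in>{1..}. \<Sum>\<^sub>\<infinity>C\<in>primitive_classes G. dyn_term q f s \<beta> k C))"


section \<open>Holomorphic functions of two complex variables\<close>

text \<open>On an open set: the Frechet derivative exists at every point and is complex linear.\<close>

definition holomorphic2_on :: "(complex \<times> complex \<Rightarrow> complex) \<Rightarrow> (complex \<times> complex) set \<Rightarrow> bool" where
  "holomorphic2_on D S \<longleftrightarrow>
     (\<forall>p \<in> S. \<exists>a b. (D has_derivative (\<lambda>(h, k). a * h + b * k)) (at p within S))"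

end

theory Submission
  imports
    Defs
    "HOL-Complex_Analysis.Complex_Analysis"
    "Jordan_Normal_Form.Schur_Decomposition"
begin

text \<open>
  The trace of the \<open>n\<close>-th power of the transfer operator on \<open>F\<^sub>m\<close> is the sum, over all closed paths of
  length \<open>n\<close>, of the product of the weights along the periodic path. Every closed path is a unique
  power of a unique rotation of a chosen primitive representative, so the double series in the
  exponent of the dynamical determinant is a regrouping of \<open>\<Sum>\<^sub>n z\<^sup>n tr(L\<^sup>n) / n\<close> with
  \<open>z = q\<^bsup>1/2 + is\<^esup>\<close>, and \<open>exp (- \<Sum>\<^sub>n z\<^sup>n tr(L\<^sup>n) / n) = det (1 - z L)\<close>. The series converges absolutely in
  the stated half plane because there are at most \<open>O(q\<^sup>n)\<close> closed paths of length \<open>n\<close>.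
\<close>


section \<open>Power sums of eigenvalues\<close>

text \<open>The two series weigh their terms differently: in the trace series each closed path of
  length \<open>n\<close> carries \<open>1 / n\<close>, in the dynamical determinant the
  \<open>k\<close>-th power of a class of primitive length \<open>l\<close> carries
  \<open>1 / k\<close>. The \<open>l\<close> rotations of the primitive root give \<open>l\<close>
  distinct closed paths of length \<open>n = k * l\<close> with equal weights, and
  \<open>l / n = 1 / k\<close>. The regrouping is thus a bijection without cancellation, and
  absolute convergence passes in both directions. This yields the determinant formula on the whole
  domain of absolute convergence, not just in the half plane, as the continuation requires.

  A second obstacle is that the operator determinant is defined through an unspecified basis. A
  function of depth \<open>m\<close> is determined by its values at finitely many paths, one for
  each word of \<open>m\<close> edges that occurs; this gives an explicit matrix whose traces are
  sums of values at those paths.\<close>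

definition mat_trace :: "'a::comm_ring_1 Matrix.mat \<Rightarrow> 'a" where
  "mat_trace A = (\<Sum>i<dim_row A. A $$ (i, i))"

lemma mat_trace_mult_comm:
  assumes "A \<in> carrier_mat n m" "B \<in> carrier_mat m n"
  shows "mat_trace (A * B) = mat_trace (B * A)"
proof -
  have "mat_trace (A * B) = (\<Sum>i<n. \<Sum>j<m. A $$ (i, j) * B $$ (j, i))"
    using assms by (auto simp: mat_trace_def scalar_prod_def lessThan_atLeast0 intro!: sum.cong)
  also have "\<dots> = (\<Sum>j<m. \<Sum>i<n. A $$ (i, j) * B $$ (j, i))"
    by (rule sum.swap)
  also have "\<dots> = mat_trace (B * A)"
    using assms
    by (auto simp: mat_trace_def scalar_prod_def lessThan_atLeast0 mult.commute intro!: sum.cong)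
  finally show ?thesis .
qed

lemma mat_trace_similar:
  assumes "similar_mat_wit A B P Q"
  shows "mat_trace A = mat_trace B"
proof -
  obtain n where n: "A \<in> carrier_mat n n" "B \<in> carrier_mat n n" "P \<in> carrier_mat n n"
    "Q \<in> carrier_mat n n" "Q * P = 1\<^sub>m n" "A = P * B * Q"
    using assms by (auto simp: similar_mat_wit_def Let_def)
  have "mat_trace A = mat_trace (P * (B * Q))"
    using n by (simp add: assoc_mult_mat[of _ n n _ n _ n])
  also have "\<dots> = mat_trace (B * Q * P)"
    using n by (intro mat_trace_mult_comm[of _ n n]) auto
  also have "\<dots> = mat_trace B"
    using n by (simp add: assoc_mult_mat[of _ n n _ n _ n])
  finally show ?thesis .
qed

lemma upper_triangular_mult:
  fixes A B :: "'a::comm_ring_1 Matrix.mat"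
  assumes A: "A \<in> carrier_mat n n" "upper_triangular A"
    and B: "B \<in> carrier_mat n n" "upper_triangular B"
  shows "upper_triangular (A * B)"
    and "i < n \<Longrightarrow> (A * B) $$ (i, i) = A $$ (i, i) * B $$ (i, i)"
proof -
  have entry: "(A * B) $$ (i, j) = (\<Sum>k<n. A $$ (i, k) * B $$ (k, j))" if "i < n" "j < n" for i j
    using that A B by (simp add: scalar_prod_def lessThan_atLeast0)
  show "upper_triangular (A * B)"
  proof
    fix i j assume ij: "i < dim_row (A * B)" "j < i"
    have "A $$ (i, k) * B $$ (k, j) = 0" if "k < n" for k
    proof (cases "k < i")
      case True thus ?thesis using A ij upper_triangularD[of A k i] by simp
    next
      case False thus ?thesis using B ij that upper_triangularD[of B j k] by simp
    qed
    thus "(A * B) $$ (i, j) = 0"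
      using entry[of i j] ij A by simp
  qed
  show "(A * B) $$ (i, i) = A $$ (i, i) * B $$ (i, i)" if i: "i < n"
  proof -
    have "A $$ (i, k) * B $$ (k, i) = (if k = i then A $$ (i, i) * B $$ (i, i) else 0)"
      if "k < n" for k
      using A B i that upper_triangularD[of A k i] upper_triangularD[of B i k]
      by (cases k i rule: linorder_cases) auto
    hence "(\<Sum>k<n. A $$ (i, k) * B $$ (k, i)) = (\<Sum>k<n. if k = i then A $$ (i, i) * B $$ (i, i) else 0)"
      by (intro sum.cong) (simp_all only: lessThan_iff)
    thus ?thesis unfolding entry[OF i i] using i by simp
  qed
qed

lemma upper_triangular_pow:
  fixes A :: "'a::comm_ring_1 Matrix.mat"
  assumes A: "A \<in> carrier_mat n n" "upper_triangular A"
  shows "upper_triangular (A ^\<^sub>m k) \<and> (\<forall>i<n. (A ^\<^sub>m k) $$ (i, i) = A $$ (i, i) ^ k)"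
proof (induction k)
  case (Suc k)
  have "A ^\<^sub>m k \<in> carrier_mat n n" using A by simp
  with Suc A show ?case
    using upper_triangular_mult[of "A ^\<^sub>m k" n A] by (simp add: mult.commute)
qed (use A in auto)

text \<open>Over the complex numbers the matrix is similar to an upper triangular one, and the
  \<open>\<mu> i\<close> are its diagonal entries. Similarity changes neither the determinant nor
  the traces of powers, and for a triangular matrix both are read off the diagonal.\<close>

lemma eigenvalue_list_exists:
  fixes M :: "complex Matrix.mat"
  assumes M: "M \<in> carrier_mat n n"
  obtains \<mu> :: "nat \<Rightarrow> complex" where
    "\<And>z. Determinant.det (1\<^sub>m n - z \<cdot>\<^sub>m M) = (\<Prod>i<n. 1 - z * \<mu> i)"
    "\<And>k. mat_trace (M ^\<^sub>m k) = (\<Sum>i<n. \<mu> i ^ k)"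
proof -
  from char_poly_factorized[OF M] obtain as where
    "char_poly M = (\<Prod>a\<leftarrow>as. [:- a, 1:])" by blast
  from schur_decomposition_exists[OF M this] obtain B where
    B: "B \<in> carrier_mat n n" "upper_triangular B" "similar_mat M B" by blast
  then obtain P Q where PQ: "similar_mat_wit M B P Q" by (auto simp: similar_mat_def)
  from similar_mat_witD2[OF M PQ] have
    d: "P * Q = 1\<^sub>m n" "Q * P = 1\<^sub>m n" "M = P * B * Q" "P \<in> carrier_mat n n" "Q \<in> carrier_mat n n"
    by auto
  show ?thesis
  proof (rule that[of "\<lambda>i. B $$ (i, i)"])
    fix z
    have "1\<^sub>m n - z \<cdot>\<^sub>m M = P * (1\<^sub>m n - z \<cdot>\<^sub>m B) * Q"
    proof -
      have "P * (1\<^sub>m n - z \<cdot>\<^sub>m B) * Q = P * 1\<^sub>m n * Q - P * (z \<cdot>\<^sub>m B) * Q"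
        using d(4,5) B(1) by (subst mult_minus_distrib_mat[of _ n n _ n])
          (auto simp: minus_mult_distrib_mat[of _ n n _ _ n])
      also have "\<dots> = 1\<^sub>m n - z \<cdot>\<^sub>m M"
        using d B(1) by (simp add: mult_smult_distrib[of _ n n _ n] mult_smult_assoc_mat[of _ n n _ n])
      finally show ?thesis by simp
    qed
    hence "similar_mat (1\<^sub>m n - z \<cdot>\<^sub>m M) (1\<^sub>m n - z \<cdot>\<^sub>m B)"
      using d M B by (intro similar_matI[of _ _ P Q n]) auto
    hence "Determinant.det (1\<^sub>m n - z \<cdot>\<^sub>m M) = Determinant.det (1\<^sub>m n - z \<cdot>\<^sub>m B)"
      by (rule det_similar)
    also have "\<dots> = prod_list (diag_mat (1\<^sub>m n - z \<cdot>\<^sub>m B))"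
      using B upper_triangularD[OF B(2)] by (intro det_upper_triangular[of _ n]) auto
    also have "\<dots> = (\<Prod>i<n. 1 - z * B $$ (i, i))"
      using B by (simp add: prod_list_diag_prod lessThan_atLeast0)
    finally show "Determinant.det (1\<^sub>m n - z \<cdot>\<^sub>m M) = (\<Prod>i<n. 1 - z * B $$ (i, i))" .
  next
    fix k
    have "mat_trace (M ^\<^sub>m k) = mat_trace (B ^\<^sub>m k)"
      by (rule mat_trace_similar[OF similar_mat_wit_pow[OF PQ]])
    also have "\<dots> = (\<Sum>i<n. B $$ (i, i) ^ k)"
      using B upper_triangular_pow[OF B(1,2)] by (simp add: mat_trace_def)
    finally show "mat_trace (M ^\<^sub>m k) = (\<Sum>i<n. B $$ (i, i) ^ k)" .
  qed
qed

text \<open>Division by zero makes the term for \<open>k = 0\<close> vanish. With this convention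
  the trace series below can run over all of \<open>nat\<close>, although the zeroth power has the
  dimension as its trace.\<close>

lemma power_div_sums_ln:
  fixes x :: complex
  assumes "norm x < 1"
  shows "(\<lambda>k. x ^ k / of_nat k) sums (- ln (1 - x))"
proof -
  have "(\<lambda>k. - ((- 1) ^ Suc k / of_nat k * (- x) ^ k)) sums (- ln (1 + - x))"
    using assms by (intro sums_minus Ln_series) simp
  moreover have "- ((- 1) ^ Suc k / of_nat k * (- x) ^ k) = x ^ k / of_nat k" for k
    by (cases "even k") simp_all
  ultimately show ?thesis by (simp only: add_uminus_conv_diff)
qed

text \<open>
  Near \<open>0\<close> the identity comes from the logarithm series; it spreads to the open disc of radius
  \<open>\<bar>z\<bar>\<close> by the identity theorem and to \<open>z\<close> itself by continuity on the closed disc. Only absolute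
  convergence at \<open>z\<close> is assumed, nothing about the size of the eigenvalues.
\<close>

lemma exp_power_sums_eq_prod:
  fixes \<mu> :: "nat \<Rightarrow> complex"
  assumes sum: "summable (\<lambda>k. norm ((\<Sum>i<n. \<mu> i ^ k) * z ^ k / of_nat k))"
  shows "exp (- (\<Sum>k. (\<Sum>i<n. \<mu> i ^ k) * z ^ k / of_nat k)) = (\<Prod>i<n. 1 - z * \<mu> i)"
proof (cases "z = 0")
  case True
  have "(\<lambda>k. (\<Sum>i<n. \<mu> i ^ k) * z ^ k / of_nat k) = (\<lambda>_. 0)"
  proof
    show "(\<Sum>i<n. \<mu> i ^ k) * z ^ k / of_nat k = 0" for k
      using True by (cases k) auto
  qed
  hence "(\<Sum>k. (\<Sum>i<n. \<mu> i ^ k) * z ^ k / of_nat k) = 0" by (simp only: suminf_zero)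
  with True show ?thesis by simp
next
  case False
  define c where "c = (\<lambda>k. (\<Sum>i<n. \<mu> i ^ k) / of_nat k)"
  define S where "S = (\<lambda>w. \<Sum>k. c k * w ^ k)"
  define P where "P = (\<lambda>w. \<Prod>i<n. 1 - w * \<mu> i)"
  define r where "r = norm z"
  have r: "r > 0" using False by (simp add: r_def)
  have c_sum: "summable (\<lambda>k. norm (c k * z ^ k))"
    using sum by (simp add: c_def)
  have unif: "uniform_limit (cball 0 r) (\<lambda>N w. \<Sum>k<N. c k * w ^ k) S sequentially"
    unfolding S_def
  proof (rule Weierstrass_m_test[OF _ c_sum])
    fix k and w :: complex assume "w \<in> cball 0 r"
    thus "norm (c k * w ^ k) \<le> norm (c k * z ^ k)"
      by (auto simp: norm_mult norm_power r_def intro!: mult_left_mono power_mono)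
  qed
  have cont: "continuous_on (cball 0 r) S"
    by (rule uniform_limit_theorem[OF _ unif]) (auto intro!: always_eventually continuous_intros)
  have holo: "S holomorphic_on ball 0 r"
  proof (rule power_series_holomorphic[where a = c])
    fix w :: complex assume "w \<in> ball 0 r"
    hence "norm w < norm z" by (simp add: r_def)
    from powser_inside[OF summable_norm_cancel[OF c_sum] this]
    show "(\<lambda>k. c k * (w - 0) ^ k) sums S w"
      by (simp add: S_def summable_sums)
  qed
  obtain B where B: "B > 0" "\<And>i. i < n \<Longrightarrow> norm (\<mu> i) < B"
  proof -
    have "norm (\<mu> i) < 1 + (\<Sum>i<n. norm (\<mu> i))" if "i < n" for i
      using member_le_sum[of i "{..<n}" "\<lambda>i. norm (\<mu> i)"] that by simp
    moreover have "1 + (\<Sum>i<n. norm (\<mu> i)) > 0"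
      by (simp add: add_pos_nonneg sum_nonneg)
    ultimately show ?thesis using that by blast
  qed
  \<comment> \<open>Below \<open>1 / B\<close> every \<open>w * \<mu> i\<close> has norm less than
    one, so the logarithm series converges for each eigenvalue; below \<open>r\<close> the point
    stays in the disc where \<open>S\<close> is holomorphic.\<close>
  define \<rho> where "\<rho> = min r (1 / B)"
  have near: "exp (- S w) = P w" if w: "w \<in> ball 0 \<rho>" for w
  proof -
    have lt: "norm (w * \<mu> i) < 1" if "i < n" for i
    proof -
      have "norm w < 1 / B" using w by (simp add: \<rho>_def)
      hence "norm w * B < 1" using B(1) by (simp add: field_simps)
      moreover have "norm w * norm (\<mu> i) \<le> norm w * B"
        using B(2)[OF that] by (intro mult_left_mono) auto
      ultimately show ?thesis by (simp add: norm_mult)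
    qed
    have "(\<lambda>k. \<Sum>i<n. (w * \<mu> i) ^ k / of_nat k) sums (\<Sum>i<n. - ln (1 - w * \<mu> i))"
      using lt by (intro sums_sum power_div_sums_ln) auto
    moreover have "(\<lambda>k. \<Sum>i<n. (w * \<mu> i) ^ k / of_nat k) = (\<lambda>k. c k * w ^ k)"
      by (rule ext) (simp add: c_def power_mult_distrib sum_divide_distrib[symmetric]
            sum_distrib_left[symmetric] mult.commute)
    ultimately have "S w = (\<Sum>i<n. - ln (1 - w * \<mu> i))"
      unfolding S_def by (metis sums_unique)
    hence "- S w = (\<Sum>i<n. ln (1 - w * \<mu> i))"
      by (simp only: sum_negf minus_minus)
    \<comment> \<open>Only \<open>exp (ln x) = x\<close> is used, factor by factor, so the sum of
      principal logarithms never has to be the principal logarithm of the product.\<close>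
    hence "exp (- S w) = (\<Prod>i<n. exp (ln (1 - w * \<mu> i)))"
      by (simp only: exp_sum finite_lessThan)
    also have "\<dots> = P w"
      unfolding P_def
    proof (rule prod.cong[OF refl])
      fix i assume "i \<in> {..<n}"
      hence "norm (w * \<mu> i) < 1" by (simp add: lt)
      hence "1 - w * \<mu> i \<noteq> 0" by (metis eq_iff_diff_eq_0 less_irrefl norm_one)
      thus "exp (ln (1 - w * \<mu> i)) = 1 - w * \<mu> i" by (rule exp_Ln)
    qed
    finally show ?thesis .
  qed
  have inner: "exp (- S w) - P w = 0" if "w \<in> ball 0 r" for w
  proof -
    have "exp (- S w) = P w"
    proof (rule analytic_continuation_open[of "ball 0 \<rho>" "ball 0 r" "\<lambda>w. exp (- S w)" P])
      show "P holomorphic_on ball 0 r" unfolding P_def by (intro holomorphic_intros)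
      show "(\<lambda>w. exp (- S w)) holomorphic_on ball 0 r" using holo by (intro holomorphic_intros)
      have "\<rho> > 0" using r B(1) by (simp add: \<rho>_def)
      thus "ball 0 \<rho> \<noteq> ({} :: complex set)" by (metis centre_in_ball empty_iff)
      show "ball 0 \<rho> \<subseteq> (ball 0 r :: complex set)" unfolding \<rho>_def by (intro subset_ball) simp
      show "exp (- S v) = P v" if "v \<in> ball 0 \<rho>" for v using near[OF that] .
      show "w \<in> ball 0 r" by fact
    qed (fact open_ball connected_ball)+
    thus ?thesis by simp
  qed
  have "exp (- S z) - P z = 0"
  proof (rule continuous_constant_on_closure[of "ball 0 r" "\<lambda>w. exp (- S w) - P w"])
    show "continuous_on (closure (ball 0 r)) (\<lambda>w. exp (- S w) - P w)"
      unfolding closure_ball[OF r] P_def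
      by (intro continuous_on_diff continuous_on_exp continuous_on_minus cont
          continuous_on_prod continuous_on_mult continuous_on_const continuous_on_id)
    show "z \<in> closure (ball 0 r)" using r by (simp add: r_def)
  qed (fact inner)
  thus ?thesis by (simp add: S_def P_def c_def)
qed

lemma exp_trace_sum_eq_det:
  fixes M :: "complex Matrix.mat"
  assumes M: "M \<in> carrier_mat n n"
    and sum: "summable (\<lambda>k. norm (mat_trace (M ^\<^sub>m k) * z ^ k / of_nat k))"
  shows "exp (- (\<Sum>k. mat_trace (M ^\<^sub>m k) * z ^ k / of_nat k)) = Determinant.det (1\<^sub>m n - z \<cdot>\<^sub>m M)"
proof -
  obtain \<mu> where l: "\<And>z. Determinant.det (1\<^sub>m n - z \<cdot>\<^sub>m M) = (\<Prod>i<n. 1 - z * \<mu> i)"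
    "\<And>k. mat_trace (M ^\<^sub>m k) = (\<Sum>i<n. \<mu> i ^ k)"
    using eigenvalue_list_exists[OF M] by metis
  show ?thesis using exp_power_sums_eq_prod[of \<mu> n z] sum unfolding l by blast
qed


section \<open>Closed paths and their primitive roots\<close>

text \<open>Powers of a nonempty word share their infinite repetition, and rotating a word shifts
  it. Statements about rotations and powers thus become equations between functions. The empty word
  has to be excluded, since \<open>i mod 0 = i\<close> points outside it.\<close>

definition periodic :: "'a list \<Rightarrow> nat \<Rightarrow> 'a" where
  "periodic c i = c ! (i mod length c)"

lemma periodic_rotate:
  assumes "c \<noteq> []"
  shows "periodic (rotate k c) i = periodic c (i + k)"
proof -
  have "periodic (rotate k c) i = c ! ((k + i mod length c) mod length c)"
    using assms by (simp add: periodic_def nth_rotate)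
  also have "(k + i mod length c) mod length c = (i + k) mod length c"
    by (metis add.commute mod_add_right_eq)
  finally show ?thesis by (simp add: periodic_def)
qed

lemma periodic_add_length:
  "periodic c (i + length c) = periodic c i"
  by (simp add: periodic_def)

lemma length_concat_replicate:
  "length (concat (replicate k c)) = k * length c"
  by (induction k) auto

lemma nth_concat_replicate:
  "i < k * length c \<Longrightarrow> concat (replicate k c) ! i = c ! (i mod length c)"
proof (induction k arbitrary: i)
  case (Suc k)
  show ?case
  proof (cases "i < length c")
    case False
    with Suc.prems have "i - length c < k * length c" by auto
    with Suc.IH[OF this] False show ?thesis
      by (simp add: nth_append le_mod_geq)
  qed (simp add: nth_append)
qed simp

lemma periodic_concat_replicate:
  assumes "k \<ge> 1" "c \<noteq> []"
  shows "periodic (concat (replicate k c)) = periodic c"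
proof
  fix i
  have "i mod (k * length c) < k * length c"
    using assms by (simp add: Suc_le_eq)
  thus "periodic (concat (replicate k c)) i = periodic c i"
    by (simp add: periodic_def length_concat_replicate nth_concat_replicate mod_mod_cancel)
qed

lemma list_eq_if_periodic_eq:
  assumes "length c = length d" "periodic c = periodic d"
  shows "c = d"
proof (rule nth_equalityI)
  fix i assume "i < length c"
  thus "c ! i = d ! i"
    using assms(1) fun_cong[OF assms(2), of i] by (simp add: periodic_def)
qed fact

lemma rotate_concat_replicate:
  assumes "k \<ge> 1"
  shows "rotate j (concat (replicate k c)) = concat (replicate k (rotate j c))"
proof (cases "c = []")
  case False
  moreover have "concat (replicate k c) \<noteq> []"
    using assms False by (cases k) auto
  ultimately show ?thesis
    using assms by (intro list_eq_if_periodic_eq ext)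
      (simp_all add: length_concat_replicate periodic_rotate periodic_concat_replicate)
qed simp

lemma rotate_inverse:
  obtains k' where "rotate k' (rotate k c) = c"
proof
  \<comment> \<open>Together with the first rotation this makes \<open>length c * k\<close> steps, a
    whole number of turns.\<close>
  show "rotate (length c * k - k) (rotate k c) = c"
  proof (cases "c = []")
    case False
    hence "length c * k \<ge> k" by (cases "length c") auto
    thus ?thesis by (simp add: rotate_rotate rotate_id)
  qed simp
qed

lemma range_rotate_rotate:
  "range (\<lambda>n. rotate n (rotate k c)) = range (\<lambda>n. rotate n c)"
proof (intro equalityI subsetI)
  fix d assume "d \<in> range (\<lambda>n. rotate n (rotate k c))"
  thus "d \<in> range (\<lambda>n. rotate n c)" by (auto simp: rotate_rotate)
next
  fix d assume "d \<in> range (\<lambda>n. rotate n c)"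
  then obtain n where n: "d = rotate n c" by blast
  obtain k' where "rotate k' (rotate k c) = c" by (rule rotate_inverse)
  hence "d = rotate (n + k') (rotate k c)" unfolding n by (metis rotate_rotate)
  thus "d \<in> range (\<lambda>n. rotate n (rotate k c))" by (rule range_eqI)
qed

text \<open>Moving the window by one step exchanges \<open>F j\<close> for the equal value
  \<open>F (j + l)\<close>. The offset \<open>j\<close> serves both the start of a rotated
  representative and the delay in a one-sided reduction.\<close>

lemma sum_periodic:
  fixes F :: "nat \<Rightarrow> 'a::comm_semiring_1"
  assumes "\<And>i. F (i + l) = F i"
  shows "(\<Sum>i<k * l. F (i + j)) = of_nat k * (\<Sum>i<l. F i)"
proof -
  have shift: "(\<Sum>i<l. F (i + j)) = (\<Sum>i<l. F i)" for j
  proof (induction j)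
    case (Suc j)
    have "(\<Sum>i<l. F (i + Suc j)) = (\<Sum>i<l. F (Suc i + j))" by simp
    also have "\<dots> = (\<Sum>i<l. F (i + j))"
    proof (cases l)
      case (Suc l')
      have "F (Suc l' + j) = F (0 + j)"
        using assms[of j] Suc by (simp add: add.commute)
      thus ?thesis
        unfolding Suc by (subst sum.lessThan_Suc, subst sum.lessThan_Suc_shift) (simp add: add.commute)
    qed simp
    finally show ?case using Suc by simp
  qed simp
  show ?thesis
  proof (induction k)
    case (Suc k)
    have split: "(\<Sum>i<a + b. f i) = (\<Sum>i<a. f i) + (\<Sum>i<b. f (a + i))"
      for a b and f :: "nat \<Rightarrow> 'a"
      by (induction b) (simp_all add: add.assoc)
    have "(\<Sum>i<Suc k * l. F (i + j)) = (\<Sum>i<k * l. F (i + j)) + (\<Sum>i<l. F (i + (k * l + j)))"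
      using split[of "\<lambda>i. F (i + j)" "k * l" l] by (simp add: ac_simps)
    thus ?case using Suc shift by (simp add: algebra_simps)
  qed simp
qed

text \<open>As periodic points of the shift, closed paths can be compared with the fibres over which
  the transfer operator sums. In the converse direction \<open>length c \<ge> 3\<close> has to be
  recovered from simplicity of the graph: length one would need a loop, and in length two
  admissibility both ways would make each edge the reverse of the other.\<close>

lemma closed_path_iff_periodic:
  assumes "pair_graph G"
  shows "closed_path G c \<longleftrightarrow> c \<noteq> [] \<and> periodic c \<in> paths_plus G"
proof
  assume c: "closed_path G c"
  hence ne: "c \<noteq> []" by (auto simp: closed_path_def)
  have "periodic c i \<in> parcs G \<and> admissible_pair (periodic c i) (periodic c (Suc i))" for i
  proof -
    define r where "r = i mod length c"
    have r: "r < length c" using ne by (simp add: r_def)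
    have "c ! r \<in> parcs G" using c r by (auto simp: closed_path_def)
    moreover have "admissible_pair (c ! r) (c ! (Suc i mod length c))"
    proof (cases "Suc r = length c")
      case True
      hence "Suc i mod length c = 0" unfolding r_def by (simp add: mod_Suc)
      moreover have "last c = c ! r" using ne True by (metis last_conv_nth diff_Suc_1)
      ultimately show ?thesis using c ne by (simp add: closed_path_def hd_conv_nth)
    next
      case False
      hence "Suc i mod length c = Suc r" unfolding r_def by (simp add: mod_Suc)
      thus ?thesis using c r False by (simp add: closed_path_def successively_conv_nth)
    qed
    ultimately show ?thesis by (simp add: periodic_def r_def)
  qed
  with ne show "c \<noteq> [] \<and> periodic c \<in> paths_plus G" by (simp add: paths_plus_def)
next
  interpret pair_graph G by fact
  assume "c \<noteq> [] \<and> periodic c \<in> paths_plus G"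
  hence ne: "c \<noteq> []"
    and arc: "\<And>i. periodic c i \<in> parcs G"
    and adm: "\<And>i. admissible_pair (periodic c i) (periodic c (Suc i))"
    by (auto simp: paths_plus_def)
  have nth: "c ! i = periodic c i" if "i < length c" for i
    using that by (simp add: periodic_def)
  have "length c \<noteq> 1"
  proof
    assume "length c = 1"
    hence "admissible_pair (periodic c 0) (periodic c 0)"
      using adm[of 0] by (simp add: periodic_def)
    thus False using pair_no_loops[OF arc[of 0]] by (simp add: admissible_pair_def)
  qed
  moreover have "length c \<noteq> 2"
  proof
    assume l: "length c = 2"
    have "admissible_pair (periodic c 0) (periodic c 1)" "admissible_pair (periodic c 1) (periodic c 0)"
      using adm[of 0] adm[of 1] l by (simp_all add: periodic_def numeral_2_eq_2)
    thus False by (auto simp: admissible_pair_def prod_eq_iff)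
  qed
  moreover have "length c \<noteq> 0" using ne by simp
  ultimately have "length c \<ge> 3" by linarith
  moreover have "set c \<subseteq> parcs G"
    by (metis arc nth in_set_conv_nth subsetI)
  moreover have "successively admissible_pair c"
    using adm by (auto simp: successively_conv_nth nth)
  moreover have "admissible_pair (last c) (hd c)"
    using adm[of "length c - 1"] ne by (simp add: periodic_def last_conv_nth hd_conv_nth)
  ultimately show "closed_path G c" by (simp add: closed_path_def)
qed

lemma paths_plus_shift:
  "p \<in> paths_plus G \<Longrightarrow> (\<lambda>i. p (i + k)) \<in> paths_plus G"
  by (auto simp: paths_plus_def)

lemma closed_path_rotate:
  assumes "pair_graph G" "closed_path G c"
  shows "closed_path G (rotate k c)"
proof -
  have "c \<noteq> []" "periodic c \<in> paths_plus G"
    using assms by (simp_all add: closed_path_iff_periodic)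
  moreover from this have "periodic (rotate k c) = (\<lambda>i. periodic c (i + k))"
    by (intro ext periodic_rotate)
  ultimately show ?thesis
    using assms(1) paths_plus_shift[of "periodic c" G k] by (simp add: closed_path_iff_periodic)
qed

lemma closed_path_concat_replicate_iff:
  assumes "pair_graph G" "k \<ge> 1"
  shows "closed_path G (concat (replicate k c)) \<longleftrightarrow> closed_path G c"
proof (cases "c = []")
  case False
  moreover have "concat (replicate k c) \<noteq> []"
    using assms False by (cases k) auto
  ultimately show ?thesis
    using assms by (simp add: closed_path_iff_periodic periodic_concat_replicate)
qed (simp add: closed_path_def)

section \<open>Primitive roots and rotation orbits\<close>

lemma primitive_path_rotate:
  assumes G: "pair_graph G" and c: "primitive_path G c"
  shows "primitive_path G (rotate k c)"
  unfolding primitive_path_def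
proof (intro conjI notI)
  show "closed_path G (rotate k c)"
    using G c by (simp add: primitive_path_def closed_path_rotate)
  assume "\<exists>d n. closed_path G d \<and> length d < length (rotate k c) \<and> rotate k c = concat (replicate n d)"
  then obtain d n where d: "closed_path G d" "length d < length c" "rotate k c = concat (replicate n d)"
    by auto
  have "n \<ge> 1" using d c by (cases n) (auto simp: primitive_path_def closed_path_def)
  obtain k' where "rotate k' (rotate k c) = c" by (rule rotate_inverse)
  hence "c = concat (replicate n (rotate k' d))"
    using \<open>n \<ge> 1\<close> by (simp add: d(3) rotate_concat_replicate)
  moreover have "closed_path G (rotate k' d)" using G d(1) by (rule closed_path_rotate)
  ultimately show False using c d(2) unfolding primitive_path_def by (metis length_rotate)
qed

lemma primitive_root_exists:
  assumes "closed_path G c"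
  shows "\<exists>d k. primitive_path G d \<and> k \<ge> 1 \<and> c = concat (replicate k d)"
  using assms
proof (induction "length c" arbitrary: c rule: less_induct)
  case less
  show ?case
  proof (cases "primitive_path G c")
    case True
    thus ?thesis by (intro exI[of _ c] exI[of _ 1]) simp
  next
    case False
    with less.prems obtain d k where d: "closed_path G d" "length d < length c" "c = concat (replicate k d)"
      by (auto simp: primitive_path_def)
    from less.hyps[OF d(2,1)] obtain e k' where
      e: "primitive_path G e" "k' \<ge> 1" "d = concat (replicate k' e)" by blast
    have "concat (replicate k (concat (replicate k' e))) = concat (replicate (k * k') e)" for k
      by (induction k) (simp_all add: replicate_add)
    moreover have "k \<noteq> 0" using d(2,3) by (cases k) auto
    ultimately show ?thesis
      using e d(3) by (intro exI[of _ e] exI[of _ "k * k'"]) (simp add: Suc_le_eq)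
  qed
qed

text \<open>Primitivity excludes only shorter roots that are closed paths, while word combinatorics
  delivers a mere word \<open>d\<close>. It is a closed path because its repetition is that of
  \<open>c\<close>.\<close>

lemma primitive_root_of_power:
  assumes G: "pair_graph G" and c: "primitive_path G c" "c = concat (replicate k d)"
  shows "c = d"
proof -
  have k: "k \<ge> 1" using c by (cases k) (auto simp: primitive_path_def closed_path_def)
  hence "closed_path G d"
    using closed_path_concat_replicate_iff[OF G k, of d] c by (simp add: primitive_path_def)
  with c have "\<not> length d < length c" unfolding primitive_path_def by blast
  moreover have "length c = k * length d" using c(2) by (simp add: length_concat_replicate)
  moreover have "length d > 0" using \<open>closed_path G d\<close> by (auto simp: closed_path_def)
  ultimately have "k = 1" using k by (cases k) auto
  thus ?thesis using c(2) by simp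
qed

text \<open>Both \<open>c @ d\<close> and \<open>d @ c\<close> are initial segments of the common
  repetition, so the words commute; commuting words are powers of one word, and primitivity makes
  both equal to it.\<close>

lemma primitive_root_unique:
  assumes G: "pair_graph G" and c: "primitive_path G c" and d: "primitive_path G d"
    and eq: "periodic c = periodic d"
  shows "c = d"
proof -
  have "c @ d = d @ c"
  proof (rule nth_equalityI)
    fix i assume i: "i < length (c @ d)"
    have "(x @ y) ! i = periodic x i"
      if xy: "periodic x = periodic y" "i < length x + length y" for x y :: "'a edge list"
    proof (cases "i < length x")
      case False
      hence "(x @ y) ! i = periodic y (i - length x)"
        using xy by (simp add: nth_append periodic_def)
      also have "\<dots> = periodic x (i - length x + length x)"
        unfolding xy(1)[symmetric] periodic_add_length ..
      finally show ?thesis using False by simp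
    qed (simp add: nth_append periodic_def)
    from this[OF eq] this[OF eq[symmetric]] show "(c @ d) ! i = (d @ c) ! i"
      using i eq by simp
  qed simp
  then obtain m n e where "concat (replicate m e) = c" "concat (replicate n e) = d"
    using comm_append_are_replicate by blast
  with primitive_root_of_power[OF G c] primitive_root_of_power[OF G d] show ?thesis by metis
qed

text \<open>If a nontrivial rotation fixed \<open>c\<close>, the two pieces that it exchanges would
  commute, and \<open>c\<close> would be a proper power of a word. The orbit of a primitive path
  therefore has exactly \<open>length c\<close> elements.\<close>

lemma rotate_primitive_inj:
  assumes G: "pair_graph G" and c: "primitive_path G c"
    and eq: "rotate i c = rotate j c" and "i < length c" "j < length c"
  shows "i = j"
proof -
  have False if eq: "rotate i c = rotate j c" and "i < j" "j < length c" for i j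
  proof -
    define s where "s = j - i"
    have s: "0 < s" "s < length c" using that by (auto simp: s_def)
    have ne: "c \<noteq> []" using s by auto
    obtain i' where i': "rotate i' (rotate i c) = c" by (rule rotate_inverse)
    have "rotate s c = rotate s (rotate i' (rotate i c))" by (simp only: i')
    also have "\<dots> = rotate i' (rotate j c)"
    proof -
      have "s + (i' + i) = i' + j" using that by (simp add: s_def)
      thus ?thesis by (simp only: rotate_rotate)
    qed
    also have "\<dots> = c" using eq i' by simp
    finally have "drop s c @ take s c = take s c @ drop s c"
      using s by (simp add: rotate_drop_take)
    moreover have "take s c \<noteq> []" "drop s c \<noteq> []" using s by auto
    ultimately obtain n e where e: "n > 1" "concat (replicate n e) = take s c @ drop s c"
      using comm_append_is_replicate[of "take s c" "drop s c"] by metis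
    hence "c = concat (replicate n e)" by simp
    moreover from this have "c = e" by (rule primitive_root_of_power[OF G c])
    ultimately have "length c = n * length c" using length_concat_replicate[of n e] by simp
    with e(1) ne show False by simp
  qed
  with assms show ?thesis by (metis linorder_neqE_nat)
qed

lemma primitive_classes_rep:
  assumes G: "pair_graph G" and C: "C \<in> primitive_classes G"
  shows "primitive_path G (class_rep C)" and "C = range (\<lambda>n. rotate n (class_rep C))"
proof -
  from C obtain c where c: "primitive_path G c" "C = range (\<lambda>n. rotate n c)"
    by (auto simp: primitive_classes_def quotient_def)
  have "rotate 0 c \<in> C" unfolding c(2) by (rule rangeI)
  hence "class_rep C \<in> C" unfolding class_rep_def by (rule someI)
  then obtain n where n: "class_rep C = rotate n c" using c(2) by auto
  show "primitive_path G (class_rep C)" unfolding n by (rule primitive_path_rotate[OF G c(1)])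
  show "C = range (\<lambda>n. rotate n (class_rep C))"
    unfolding n range_rotate_rotate by (rule c(2))
qed

lemma primitive_class_of:
  assumes "primitive_path G c"
  shows "range (\<lambda>n. rotate n c) \<in> primitive_classes G"
proof -
  have "range (\<lambda>n. rotate n c) = {(c, d). primitive_path G c \<and> (\<exists>n. d = rotate n c)} `` {c}"
    using assms by auto
  thus ?thesis unfolding primitive_classes_def by (rule ssubst) (rule quotientI, simp add: assms)
qed

text \<open>The parameters are recovered one at a time: the repetition determines the rotated root,
  the length then gives \<open>k\<close>, the orbit of the root gives \<open>C\<close>, and the
  absence of coinciding rotations gives \<open>j\<close>.\<close>

lemma closed_paths_bij_betw:
  assumes G: "pair_graph G"
  shows "bij_betw (\<lambda>((k, C), j). concat (replicate k (rotate j (class_rep C))))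
           (Sigma ({1..} \<times> primitive_classes G) (\<lambda>(k, C). {..<class_length C})) {c. closed_path G c}"
    (is "bij_betw ?h ?S _")
  unfolding bij_betw_def
proof
  show "inj_on ?h ?S"
  proof (rule inj_onI, clarsimp)
    fix k C j k' C' j'
    assume k: "Suc 0 \<le> k" "Suc 0 \<le> k'" and C: "C \<in> primitive_classes G" "C' \<in> primitive_classes G"
      and j: "j < class_length C" "j' < class_length C'"
      and eq: "concat (replicate k (rotate j (class_rep C))) = concat (replicate k' (rotate j' (class_rep C')))"
    let ?c = "rotate j (class_rep C)" and ?d = "rotate j' (class_rep C')"
    have p: "primitive_path G ?c" "primitive_path G ?d"
      using primitive_path_rotate[OF G] primitive_classes_rep(1)[OF G] C by auto
    hence ne: "?c \<noteq> []" "?d \<noteq> []" by (auto simp: primitive_path_def closed_path_def)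
    have "periodic ?c = periodic ?d"
      using periodic_concat_replicate[OF _ ne(1), of k] periodic_concat_replicate[OF _ ne(2), of k'] k eq
      by simp
    hence cd: "?c = ?d" by (rule primitive_root_unique[OF G p])
    have "k * length ?c = k' * length ?c"
      using arg_cong[OF eq, of length] unfolding cd length_concat_replicate .
    hence "k = k'" using ne by simp
    moreover have "C = C'"
    proof -
      have "C = range (\<lambda>n. rotate n ?c)"
        unfolding range_rotate_rotate by (rule primitive_classes_rep(2)[OF G C(1)])
      also have "\<dots> = C'"
        unfolding cd range_rotate_rotate by (rule primitive_classes_rep(2)[OF G C(2), symmetric])
      finally show ?thesis .
    qed
    moreover have "j = j'"
      using rotate_primitive_inj[OF G primitive_classes_rep(1)[OF G C(1)]] cd j \<open>C = C'\<close>
      by (simp add: class_length_def)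
    ultimately show "k = k' \<and> C = C' \<and> j = j'" by blast
  qed
next
  show "?h ` ?S = {c. closed_path G c}"
  proof (intro equalityI subsetI)
    fix c assume "c \<in> ?h ` ?S"
    then obtain k C j where c: "k \<ge> 1" "C \<in> primitive_classes G"
      "c = concat (replicate k (rotate j (class_rep C)))" by auto
    moreover have "closed_path G (rotate j (class_rep C))"
      using primitive_classes_rep(1)[OF G c(2)] G by (simp add: primitive_path_def closed_path_rotate)
    ultimately show "c \<in> {c. closed_path G c}"
      using closed_path_concat_replicate_iff[OF G] by simp
  next
    fix c assume "c \<in> {c. closed_path G c}"
    then obtain d k where d: "primitive_path G d" "k \<ge> 1" "c = concat (replicate k d)"
      using primitive_root_exists by blast
    define C where "C = range (\<lambda>n. rotate n d)"
    have C: "C \<in> primitive_classes G" unfolding C_def by (rule primitive_class_of[OF d(1)])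
    have "rotate 0 d \<in> C" unfolding C_def by (rule rangeI)
    then obtain n where n: "d = rotate n (class_rep C)"
      using primitive_classes_rep(2)[OF G C] by auto
    define j where "j = n mod class_length C"
    have "class_rep C \<noteq> []" using n d(1) by (auto simp: primitive_path_def closed_path_def)
    hence "j < class_length C" by (simp add: j_def class_length_def)
    moreover have "d = rotate j (class_rep C)"
      unfolding n j_def class_length_def by (rule rotate_conv_mod)
    ultimately show "c \<in> ?h ` ?S"
      using C d by (intro image_eqI[of _ _ "((k, C), j)"]) auto
  qed
qed


section \<open>Determinants from samples\<close>

lemma sum_fun_apply:
  fixes f :: "'a \<Rightarrow> 'b \<Rightarrow> 'c::comm_monoid_add"
  shows "(\<Sum>a\<in>A. f a) y = (\<Sum>a\<in>A. f a y)"
  by (induction A rule: infinite_finite_induct) simp_all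

text \<open>\<open>op_det\<close> refers to a chosen basis about which nothing is known. Here
  \<open>V\<close> has a basis \<open>\<delta>\<close> dual to evaluation at \<open>N\<close>
  points, so that coordinates are values and the matrix entries of an operator can be
  computed.\<close>

locale sampled_space =
  fixes V :: "('x \<Rightarrow> complex) set" and N :: nat and x :: "nat \<Rightarrow> 'x" and \<delta> :: "nat \<Rightarrow> 'x \<Rightarrow> complex"
  assumes subspace: "fun_vs.subspace V"
    and \<delta>_in: "i < N \<Longrightarrow> \<delta> i \<in> V"
    and \<delta>_x: "i < N \<Longrightarrow> j < N \<Longrightarrow> \<delta> i (x j) = (if i = j then 1 else 0)"
    and expand: "\<phi> \<in> V \<Longrightarrow> \<phi> = (\<Sum>i<N. fun_scale (\<phi> (x i)) (\<delta> i))"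
begin

definition sample_matrix :: "(('x \<Rightarrow> complex) \<Rightarrow> 'x \<Rightarrow> complex) \<Rightarrow> complex Matrix.mat" where
  "sample_matrix T = Matrix.mat N N (\<lambda>(i, j). T (\<delta> j) (x i))"

lemma sample_matrix_carrier [simp]: "sample_matrix T \<in> carrier_mat N N"
  by (simp add: sample_matrix_def)

lemma apply_expand:
  assumes "Vector_Spaces.linear fun_scale fun_scale T" "\<phi> \<in> V"
  shows "T \<phi> y = (\<Sum>k<N. \<phi> (x k) * T (\<delta> k) y)"
proof -
  interpret T: Vector_Spaces.linear fun_scale fun_scale T by fact
  have "T \<phi> = T (\<Sum>k<N. fun_scale (\<phi> (x k)) (\<delta> k))"
    by (rule arg_cong[OF expand[OF assms(2)], of T])
  also have "\<dots> = (\<Sum>k<N. fun_scale (\<phi> (x k)) (T (\<delta> k)))"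
    by (simp only: T.sum T.scale)
  finally have "T \<phi> = (\<Sum>k<N. fun_scale (\<phi> (x k)) (T (\<delta> k)))" .
  from fun_cong[OF this, of y] show ?thesis
    unfolding sum_fun_apply fun_scale_def .
qed

lemma ordered_basis_\<delta>: "ordered_basis V (map \<delta> [0..<N])"
  unfolding ordered_basis_def
proof (intro conjI)
  have inj: "inj_on \<delta> {..<N}"
  proof (rule inj_onI)
    fix i j assume ij: "i \<in> {..<N}" "j \<in> {..<N}" and eq: "\<delta> i = \<delta> j"
    have "(if j = i then 1 else 0) = \<delta> j (x i)"
      using ij by (intro \<delta>_x[symmetric]) simp_all
    also have "\<dots> = 1" unfolding eq[symmetric] using ij \<delta>_x[of i i] by simp
    finally show "i = j" by (simp split: if_splits)
  qed
  thus "distinct (map \<delta> [0..<N])"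
    by (simp add: distinct_map lessThan_atLeast0)
  have set: "set (map \<delta> [0..<N]) = \<delta> ` {..<N}"
    by (simp add: lessThan_atLeast0)
  show "fun_vs.independent (set (map \<delta> [0..<N]))"
    unfolding set
  proof (rule fun_vs.independent_if_scalars_zero)
    fix u \<phi> assume zero: "(\<Sum>\<phi>\<in>\<delta> ` {..<N}. fun_scale (u \<phi>) \<phi>) = 0" and "\<phi> \<in> \<delta> ` {..<N}"
    then obtain j where j: "j < N" "\<phi> = \<delta> j" by auto
    have "(\<Sum>i<N. fun_scale (u (\<delta> i)) (\<delta> i)) = 0"
      using zero by (simp add: sum.reindex[OF inj])
    from fun_cong[OF this, of "x j"]
    have "0 = (\<Sum>i<N. fun_scale (u (\<delta> i)) (\<delta> i) (x j))"
      unfolding sum_fun_apply by simp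
    also have "\<dots> = (\<Sum>i<N. if i = j then u (\<delta> i) else 0)"
      using j by (intro sum.cong) (simp_all add: fun_scale_def \<delta>_x)
    also have "\<dots> = u \<phi>" using j by simp
    finally show "u \<phi> = 0" by simp
  qed simp
  show "fun_vs.span (set (map \<delta> [0..<N])) = V"
    unfolding set
  proof (rule antisym)
    show "fun_vs.span (\<delta> ` {..<N}) \<subseteq> V"
      using \<delta>_in by (intro fun_vs.span_minimal subspace) auto
    show "V \<subseteq> fun_vs.span (\<delta> ` {..<N})"
    proof
      fix \<phi> assume "\<phi> \<in> V"
      have "(\<Sum>i<N. fun_scale (\<phi> (x i)) (\<delta> i)) \<in> fun_vs.span (\<delta> ` {..<N})"
        by (intro fun_vs.span_sum fun_vs.span_scale fun_vs.span_base) auto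
      thus "\<phi> \<in> fun_vs.span (\<delta> ` {..<N})"
        unfolding expand[OF \<open>\<phi> \<in> V\<close>, symmetric] .
    qed
  qed
qed

text \<open>
  The matrix of values \<open>A = (b\<^sub>j (x\<^sub>i))\<close> of an arbitrary basis \<open>b\<close> is invertible and intertwines the
  matrix of \<open>T\<close> in that basis with the matrix of samples.
\<close>

lemma op_det_eq_sample_matrix:
  assumes lin: "Vector_Spaces.linear fun_scale fun_scale T" and inv: "T ` V \<subseteq> V"
  shows "op_det V T = Determinant.det (sample_matrix T)"
proof -
  define bs where "bs = (SOME bs. ordered_basis V bs)"
  have bs: "ordered_basis V bs"
    unfolding bs_def using ordered_basis_\<delta> by (rule someI)
  hence dist: "distinct bs" and ind: "fun_vs.independent (set bs)" and span: "fun_vs.span (set bs) = V"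
    by (simp_all add: ordered_basis_def)
  have len: "length bs = N"
  proof -
    have "length bs = fun_vs.dim V"
      using fun_vs.dim_eq_card_independent[OF ind] fun_vs.dim_span[of "set bs"] span
      by (simp add: distinct_card[OF dist])
    also have "\<dots> = card (set (map \<delta> [0..<N]))"
      using ordered_basis_\<delta> fun_vs.dim_eq_card_independent[of "set (map \<delta> [0..<N])"]
        fun_vs.dim_span[of "set (map \<delta> [0..<N])"]
      unfolding ordered_basis_def by argo
    also have "\<dots> = length (map \<delta> [0..<N])"
      using ordered_basis_\<delta> unfolding ordered_basis_def by (intro distinct_card) blast
    also have "\<dots> = N" by simp
    finally show ?thesis .
  qed
  have bs_in: "bs ! j \<in> V" if "j < N" for j
    using that len span fun_vs.span_base[of "bs ! j" "set bs"] by simp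
  have rep: "(\<Sum>k<N. (bs ! k) y * fun_vs.representation (set bs) \<phi> (bs ! k)) = \<phi> y" if "\<phi> \<in> V" for \<phi> y
  proof -
    have "(\<Sum>b\<in>set bs. fun_scale (fun_vs.representation (set bs) \<phi> b) b) = \<phi>"
      using that span by (intro fun_vs.sum_representation_eq[OF ind]) auto
    from fun_cong[OF this, of y, symmetric]
    have "\<phi> y = (\<Sum>b\<in>set bs. fun_scale (fun_vs.representation (set bs) \<phi> b) b y)"
      unfolding sum_fun_apply .
    also have "\<dots> = (\<Sum>b\<in>set bs. b y * fun_vs.representation (set bs) \<phi> b)"
      by (simp only: fun_scale_def mult.commute)
    also have "\<dots> = (\<Sum>k<N. (bs ! k) y * fun_vs.representation (set bs) \<phi> (bs ! k))"
      using sum.reindex_bij_betw[OF bij_betw_nth[OF dist refl refl],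
          of "\<lambda>b. b y * fun_vs.representation (set bs) \<phi> b"] len by simp
    finally show ?thesis by simp
  qed
  define A where "A = Matrix.mat N N (\<lambda>(i, j). (bs ! j) (x i))"
  define R where "R = Matrix.mat N N (\<lambda>(i, j). fun_vs.representation (set bs) (\<delta> j) (bs ! i))"
  have carr: "A \<in> carrier_mat N N" "R \<in> carrier_mat N N" "op_matrix bs T \<in> carrier_mat N N"
    by (simp_all add: A_def R_def op_matrix_def len)
  \<comment> \<open>Column \<open>j\<close> of \<open>R\<close> holds the coordinates of
    \<open>\<delta> j\<close> in \<open>bs\<close>; multiplication by \<open>A\<close> evaluates
    this combination at the points, and duality gives the identity matrix.\<close>
  have "A * R = 1\<^sub>m N"
    by (rule eq_matI)
      (auto simp: A_def R_def scalar_prod_def rep \<delta>_in \<delta>_x simp flip: lessThan_atLeast0)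
  hence "Determinant.det A * Determinant.det R = 1"
    using det_mult[OF carr(1,2)] by simp
  hence "Determinant.det A \<noteq> 0" by auto
  moreover have "A * op_matrix bs T = sample_matrix T * A"
  proof (rule eq_matI)
    fix i j assume "i < dim_row (sample_matrix T * A)" "j < dim_col (sample_matrix T * A)"
    hence ij: "i < N" "j < N" by (simp_all add: A_def sample_matrix_def)
    have "T (bs ! j) \<in> V" using inv bs_in[OF ij(2)] by auto
    hence "(A * op_matrix bs T) $$ (i, j) = T (bs ! j) (x i)"
      using ij by (simp add: A_def op_matrix_def len scalar_prod_def rep flip: lessThan_atLeast0)
    also have "\<dots> = (sample_matrix T * A) $$ (i, j)"
      using ij apply_expand[OF lin bs_in[OF ij(2)], of "x i"]
      by (simp add: A_def sample_matrix_def scalar_prod_def mult.commute flip: lessThan_atLeast0)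
    finally show "(A * op_matrix bs T) $$ (i, j) = (sample_matrix T * A) $$ (i, j)" .
  qed (simp_all add: A_def op_matrix_def sample_matrix_def len)
  ultimately have "Determinant.det (op_matrix bs T) = Determinant.det (sample_matrix T)"
    using det_mult[OF carr(1,3)] det_mult[OF sample_matrix_carrier carr(1)] by simp
  thus ?thesis by (simp add: op_det_def bs_def)
qed

lemma sample_matrix_comp:
  assumes "Vector_Spaces.linear fun_scale fun_scale S" "T ` V \<subseteq> V"
  shows "sample_matrix (S \<circ> T) = sample_matrix S * sample_matrix T"
proof (rule eq_matI)
  fix i j assume "i < dim_row (sample_matrix S * sample_matrix T)"
    "j < dim_col (sample_matrix S * sample_matrix T)"
  hence ij: "i < N" "j < N" by (simp_all add: sample_matrix_def)
  have "T (\<delta> j) \<in> V" using assms(2) \<delta>_in[OF ij(2)] by auto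
  from apply_expand[OF assms(1) this, of "x i"] ij
  show "sample_matrix (S \<circ> T) $$ (i, j) = (sample_matrix S * sample_matrix T) $$ (i, j)"
    by (simp add: sample_matrix_def scalar_prod_def mult.commute flip: lessThan_atLeast0)
qed (simp_all add: sample_matrix_def)

lemma linear_funpow:
  fixes T :: "('x \<Rightarrow> complex) \<Rightarrow> 'x \<Rightarrow> complex"
  assumes "Vector_Spaces.linear fun_scale fun_scale T"
  shows "Vector_Spaces.linear fun_scale fun_scale (T ^^ k)"
proof (induction k)
  case (Suc k)
  show ?case
    unfolding funpow.simps by (rule Vector_Spaces.linear_compose[OF Suc assms])
qed (unfold funpow.simps id_def, rule fun_vs.linear_ident)

lemma sample_matrix_pow:
  assumes "Vector_Spaces.linear fun_scale fun_scale T" "T ` V \<subseteq> V"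
  shows "sample_matrix T ^\<^sub>m k = sample_matrix (T ^^ k)"
proof (induction k)
  case 0
  show ?case by (rule eq_matI) (auto simp: sample_matrix_def \<delta>_x)
next
  case (Suc k)
  show ?case
    unfolding pow_mat.simps Suc funpow_Suc_right
    by (rule sample_matrix_comp[OF linear_funpow assms(2), symmetric]) fact
qed

lemma sample_matrix_id_minus_scale:
  "sample_matrix (\<lambda>\<phi>. \<phi> - fun_scale z (T \<phi>)) = 1\<^sub>m N - z \<cdot>\<^sub>m sample_matrix T"
  by (rule eq_matI) (auto simp: sample_matrix_def \<delta>_x fun_scale_def)

lemma op_det_id_minus_scale:
  assumes lin: "Vector_Spaces.linear fun_scale fun_scale T" and inv: "T ` V \<subseteq> V"
  shows "op_det V (\<lambda>\<phi>. \<phi> - fun_scale z (T \<phi>)) = Determinant.det (1\<^sub>m N - z \<cdot>\<^sub>m sample_matrix T)"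
proof -
  interpret T: Vector_Spaces.linear fun_scale fun_scale T by fact
  have "Vector_Spaces.linear fun_scale fun_scale (\<lambda>\<phi>. \<phi> - fun_scale z (T \<phi>))"
    by unfold_locales
      (simp_all only: T.add T.scale fun_vs.scale_right_distrib fun_vs.scale_right_diff_distrib
        fun_vs.scale_left_commute add_diff_add)
  moreover have "(\<lambda>\<phi>. \<phi> - fun_scale z (T \<phi>)) ` V \<subseteq> V"
    using inv by (blast intro: fun_vs.subspace_diff[OF subspace] fun_vs.subspace_scale[OF subspace])
  ultimately show ?thesis
    unfolding sample_matrix_id_minus_scale[symmetric] by (rule op_det_eq_sample_matrix)
qed

lemma mat_trace_sample_matrix_pow:
  assumes "Vector_Spaces.linear fun_scale fun_scale T" "T ` V \<subseteq> V"
  shows "mat_trace (sample_matrix T ^\<^sub>m k) = (\<Sum>i<N. (T ^^ k) (\<delta> i) (x i))"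
  unfolding sample_matrix_pow[OF assms] by (simp add: mat_trace_def sample_matrix_def)

end


section \<open>Traces of the transfer operator\<close>

definition prefix_word :: "nat \<Rightarrow> (nat \<Rightarrow> 'a) \<Rightarrow> 'a list" where
  "prefix_word m p = map p [0..<m]"

lemma prefix_word_eq_iff: "prefix_word m p = prefix_word m p' \<longleftrightarrow> (\<forall>i<m. p i = p' i)"
  by (auto simp: prefix_word_def)

lemma depth_at_mostD:
  assumes "depth_at_most G m \<phi>" "p \<in> paths_plus G" "p' \<in> paths_plus G" "\<And>i. i < m \<Longrightarrow> p i = p' i"
  shows "\<phi> p = \<phi> p'"
  using assms unfolding depth_at_most_def by blast

lemma case_nat_in_paths_plus_iff:
  "case_nat e p \<in> paths_plus G \<longleftrightarrow> e \<in> parcs G \<and> admissible_pair e (p 0) \<and> p \<in> paths_plus G"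
proof -
  have "(\<forall>i. Q i) \<longleftrightarrow> Q 0 \<and> (\<forall>i. Q (Suc i))" for Q :: "nat \<Rightarrow> bool"
    by (metis not0_implies_Suc)
  from this[of "\<lambda>i. case_nat e p i \<in> parcs G \<and> admissible_pair (case_nat e p i) (case_nat e p (Suc i))"]
  show ?thesis by (simp add: paths_plus_def)
qed

lemma shift_plus_case_nat: "shift_plus (case_nat e p) = p"
  by (simp add: shift_plus_def)

lemma case_nat_shift_plus: "case_nat (p 0) (shift_plus p) = p"
  by (rule ext) (simp add: shift_plus_def split: nat.split)

lemma paths_plus_SucD:
  assumes "p \<in> paths_plus G"
  shows "p 0 \<in> parcs G" "admissible_pair (p 0) (p 1)" "shift_plus p \<in> paths_plus G"
  using assms by (auto simp: paths_plus_def shift_plus_def)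

text \<open>The fibre of the \<open>n\<close>-th iterate of \<open>shift_plus\<close> over
  \<open>p\<close>, written with indices so that no iterate has to be unfolded.\<close>

definition preimages :: "'v pair_pre_digraph \<Rightarrow> nat \<Rightarrow> (nat \<Rightarrow> 'v edge) \<Rightarrow> (nat \<Rightarrow> 'v edge) set" where
  "preimages G n p = {p' \<in> paths_plus G. (\<forall>i. p' (i + n) = p i)}"

text \<open>A point of the fibre is determined by its first \<open>n\<close> edges.\<close>

lemma finite_preimages:
  assumes "finite (parcs G)"
  shows "finite (preimages G n p)"
proof (rule finite_imageD)
  have "prefix_word n ` preimages G n p \<subseteq> {xs. set xs \<subseteq> parcs G \<and> length xs = n}"
    by (auto simp: prefix_word_def preimages_def paths_plus_def)
  thus "finite (prefix_word n ` preimages G n p)"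
    using finite_lists_length_eq[OF assms] finite_subset by blast
  show "inj_on (prefix_word n) (preimages G n p)"
  proof (rule inj_onI, rule ext)
    fix p1 p2 i
    assume p: "p1 \<in> preimages G n p" "p2 \<in> preimages G n p" and eq: "prefix_word n p1 = prefix_word n p2"
    show "p1 i = p2 i"
    proof (cases "i < n")
      case False
      have "p1 (i - n + n) = p2 (i - n + n)" using p unfolding preimages_def by auto
      thus ?thesis using False by simp
    qed (use eq in \<open>auto simp: prefix_word_eq_iff\<close>)
  qed
qed

text \<open>In the induction step the innermost application is split off: the fibre of order
  \<open>Suc n\<close> is cut into the fibres of \<open>shift_plus\<close> over the points of the
  fibre of order \<open>n\<close>, and the weight product gains the factor of the new first
  edge.\<close>

lemma transfer_op_funpow:
  assumes fin: "finite (parcs G)" and p: "p \<in> paths_plus G"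
  shows "(transfer_op G \<omega> ^^ n) \<phi> p =
    (\<Sum>p'\<in>preimages G n p. (\<Prod>i<n. \<omega> (\<lambda>j. p' (j + i))) * \<phi> p')"
proof (induction n arbitrary: \<phi>)
  case 0
  have "preimages G 0 p = {p}" using p by (auto simp: preimages_def)
  thus ?case by simp
next
  case (Suc n)
  let ?w = "\<lambda>n p'. \<Prod>i<n. \<omega> (\<lambda>j. p' (j + i))"
  have w_Suc: "?w (Suc n) p' = \<omega> p' * ?w n (shift_plus p')" for p'
    by (simp only: prod.lessThan_Suc_shift) (simp add: shift_plus_def)
  have "(transfer_op G \<omega> ^^ Suc n) \<phi> p = (transfer_op G \<omega> ^^ n) (transfer_op G \<omega> \<phi>) p"
    by (simp only: funpow_Suc_right comp_apply)
  also have "\<dots> = (\<Sum>p'\<in>preimages G n p. ?w n p' * transfer_op G \<omega> \<phi> p')"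
    by (rule Suc)
  also have "\<dots> = (\<Sum>p'\<in>preimages G n p. \<Sum>p''\<in>{p''\<in>preimages G (Suc n) p. shift_plus p'' = p'}.
      ?w (Suc n) p'' * \<phi> p'')"
  proof (rule sum.cong[OF refl])
    fix p' assume p': "p' \<in> preimages G n p"
    hence "{p''\<in>preimages G (Suc n) p. shift_plus p'' = p'} = {p'' \<in> paths_plus G. shift_plus p'' = p'}"
      by (auto simp: preimages_def shift_plus_def)
    moreover have "p' \<in> paths_plus G" using p' by (simp add: preimages_def)
    ultimately show "?w n p' * transfer_op G \<omega> \<phi> p' =
        (\<Sum>p''\<in>{p''\<in>preimages G (Suc n) p. shift_plus p'' = p'}. ?w (Suc n) p'' * \<phi> p'')"
      by (auto simp: transfer_op_def sum_distrib_left w_Suc mult_ac simp del: prod.lessThan_Suc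
          intro!: sum.cong)
  qed
  also have "\<dots> = (\<Sum>p''\<in>preimages G (Suc n) p. ?w (Suc n) p'' * \<phi> p'')"
  proof (rule sum.group)
    show "shift_plus ` preimages G (Suc n) p \<subseteq> preimages G n p"
      using paths_plus_SucD(3) by (auto simp: preimages_def shift_plus_def)
  qed (simp_all add: finite_preimages fin)
  finally show ?case .
qed

lemma linear_transfer_op: "Vector_Spaces.linear fun_scale fun_scale (transfer_op G \<omega>)"
  by unfold_locales
    (auto simp: transfer_op_def fun_scale_def fun_eq_iff sum.distrib sum_distrib_left algebra_simps)

lemma subspace_F_space: "fun_vs.subspace (F_space G m)"
proof (rule fun_vs.subspaceI)
  show "0 \<in> F_space G m" by (simp add: F_space_def depth_at_most_def)
next
  fix \<phi> \<psi> assume *: "\<phi> \<in> F_space G m" "\<psi> \<in> F_space G m"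
  show "\<phi> + \<psi> \<in> F_space G m"
    unfolding F_space_def depth_at_most_def
  proof (intro CollectI conjI ballI impI allI)
    fix p p' assume "p \<in> paths_plus G" "p' \<in> paths_plus G" "\<forall>i<m. p i = p' i"
    hence "\<phi> p = \<phi> p'" "\<psi> p = \<psi> p'"
      using * by (auto simp: F_space_def intro: depth_at_mostD)
    thus "(\<phi> + \<psi>) p = (\<phi> + \<psi>) p'" by simp
  qed (use * in \<open>simp add: F_space_def\<close>)
next
  fix c \<phi> assume *: "\<phi> \<in> F_space G m"
  show "fun_scale c \<phi> \<in> F_space G m"
    unfolding F_space_def depth_at_most_def
  proof (intro CollectI conjI ballI impI allI)
    fix p p' assume "p \<in> paths_plus G" "p' \<in> paths_plus G" "\<forall>i<m. p i = p' i"
    hence "\<phi> p = \<phi> p'"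
      using * by (auto simp: F_space_def intro: depth_at_mostD)
    thus "fun_scale c \<phi> p = fun_scale c \<phi> p'" by (simp add: fun_scale_def)
  qed (use * in \<open>simp add: F_space_def fun_scale_def\<close>)
qed

text \<open>Which edges can precede a path depends on its first edge, and \<open>m \<ge> 1\<close>
  makes this edge known. Two paths with the same first \<open>m\<close> edges then have matching
  predecessors, obtained by exchanging the tails, and matched predecessors agree even on
  \<open>m + 1\<close> edges.\<close>

lemma transfer_op_F_space:
  assumes fin: "finite (parcs G)" and m: "m \<ge> 1"
    and \<omega>: "depth_at_most G m \<omega>" and \<phi>: "\<phi> \<in> F_space G m"
  shows "transfer_op G \<omega> \<phi> \<in> F_space G m"
  unfolding F_space_def mem_Collect_eq
proof
  show "\<forall>p. p \<notin> paths_plus G \<longrightarrow> transfer_op G \<omega> \<phi> p = 0" by (simp add: transfer_op_def)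
  show "depth_at_most G m (transfer_op G \<omega> \<phi>)"
    unfolding depth_at_most_def
  proof (intro ballI impI)
    fix p1 p2 assume p: "p1 \<in> paths_plus G" "p2 \<in> paths_plus G" and eq: "\<forall>i<m. p1 i = p2 i"
    have dep: "depth_at_most G m \<phi>" using \<phi> by (simp add: F_space_def)
    have eq0: "p1 0 = p2 0" using eq m by simp
    have mem: "case_nat (p' 0) b \<in> paths_plus G"
      if "p' \<in> {p' \<in> paths_plus G. shift_plus p' = a}" "a 0 = b 0" "b \<in> paths_plus G"
      for a b p' :: "nat \<Rightarrow> 'a edge"
    proof -
      have "p' 1 = b 0" using that(1,2) by (auto simp: shift_plus_def)
      thus ?thesis
        using that(1,3) paths_plus_SucD[of p' G] by (simp add: case_nat_in_paths_plus_iff)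
    qed
    have "(\<Sum>p' \<in> {p' \<in> paths_plus G. shift_plus p' = p1}. \<omega> p' * \<phi> p') =
        (\<Sum>p' \<in> {p' \<in> paths_plus G. shift_plus p' = p2}. \<omega> p' * \<phi> p')"
    proof (rule sum.reindex_bij_witness[where i = "\<lambda>p'. case_nat (p' 0) p1" and j = "\<lambda>p'. case_nat (p' 0) p2"])
      fix p' assume p': "p' \<in> {p' \<in> paths_plus G. shift_plus p' = p1}"
      note mem' = mem[OF p' eq0 p(2)]
      show "case_nat (p' 0) p2 \<in> {p' \<in> paths_plus G. shift_plus p' = p2}"
        using mem' by (simp add: shift_plus_case_nat)
      show "case_nat (case_nat (p' 0) p2 0) p1 = p'"
        using p' case_nat_shift_plus[of p'] by simp
      have "case_nat (p' 0) p2 i = p' i" if "i < m" for i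
      proof (cases i)
        case (Suc l)
        have "p' (Suc l) = p1 l" using p' by (auto simp: shift_plus_def)
        thus ?thesis using Suc that eq by simp
      qed simp
      thus "\<omega> (case_nat (p' 0) p2) * \<phi> (case_nat (p' 0) p2) = \<omega> p' * \<phi> p'"
        using depth_at_mostD[OF \<omega> mem', of p'] depth_at_mostD[OF dep mem', of p'] p' by simp
    next
      fix p' assume p': "p' \<in> {p' \<in> paths_plus G. shift_plus p' = p2}"
      show "case_nat (p' 0) p1 \<in> {p' \<in> paths_plus G. shift_plus p' = p1}"
        using mem[OF p' eq0[symmetric] p(1)] by (simp add: shift_plus_case_nat)
      show "case_nat (case_nat (p' 0) p1 0) p2 = p'"
        using p' case_nat_shift_plus[of p'] by simp
    qed
    thus "transfer_op G \<omega> \<phi> p1 = transfer_op G \<omega> \<phi> p2"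
      using p by (simp add: transfer_op_def)
  qed
qed

text \<open>Distinctness of \<open>ws\<close> makes its positions usable as matrix indices. Only
  words that begin some infinite path are listed, because each of them needs a sample path.\<close>

locale prefix_words =
  fixes G :: "'v pair_pre_digraph" and m :: nat and ws :: "'v edge list list"
  assumes graph: "pair_graph G" and m: "m \<ge> 1"
    and ws: "distinct ws" "set ws = prefix_word m ` paths_plus G"
begin

definition sample :: "nat \<Rightarrow> nat \<Rightarrow> 'v edge" where
  "sample i = inv_into (paths_plus G) (prefix_word m) (ws ! i)"

definition cylinder :: "nat \<Rightarrow> (nat \<Rightarrow> 'v edge) \<Rightarrow> complex" where
  "cylinder i p = (if p \<in> paths_plus G \<and> prefix_word m p = ws ! i then 1 else 0)"

lemma fin: "finite (parcs G)"
proof -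
  interpret pair_graph G by (rule graph)
  show ?thesis by (rule pair_finite_arcs)
qed

lemma sample:
  assumes "i < length ws"
  shows "sample i \<in> paths_plus G" "prefix_word m (sample i) = ws ! i"
proof -
  have "ws ! i \<in> prefix_word m ` paths_plus G"
    using assms ws(2) nth_mem by blast
  thus "sample i \<in> paths_plus G" "prefix_word m (sample i) = ws ! i"
    unfolding sample_def by (fact inv_into_into, fact f_inv_into_f)
qed

lemma word_index:
  assumes "p \<in> paths_plus G"
  obtains i where "i < length ws" "prefix_word m p = ws ! i"
proof -
  have "prefix_word m p \<in> set ws" using assms ws(2) by blast
  thus ?thesis using that by (metis in_set_conv_nth)
qed

text \<open>A function of depth \<open>m\<close> is constant on each cylinder, hence the combination
  of the cylinder indicators with its values at the samples as coefficients.\<close>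

sublocale sampled_space "F_space G m" "length ws" sample cylinder
proof
  show "fun_vs.subspace (F_space G m)" by (rule subspace_F_space)
next
  fix i assume "i < length ws"
  show "cylinder i \<in> F_space G m"
    unfolding F_space_def depth_at_most_def prefix_word_eq_iff[symmetric]
    by (auto simp: cylinder_def)
next
  fix i j assume "i < length ws" "j < length ws"
  thus "cylinder i (sample j) = (if i = j then 1 else 0)"
    using ws(1) by (auto simp: cylinder_def sample nth_eq_iff_index_eq)
next
  fix \<phi> assume \<phi>: "\<phi> \<in> F_space G m"
  show "\<phi> = (\<Sum>i<length ws. fun_scale (\<phi> (sample i)) (cylinder i))"
  proof
    fix p
    show "\<phi> p = (\<Sum>i<length ws. fun_scale (\<phi> (sample i)) (cylinder i)) p"
    proof (cases "p \<in> paths_plus G")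
      case True
      then obtain k where k: "k < length ws" "prefix_word m p = ws ! k" by (rule word_index)
      have "(\<Sum>i<length ws. fun_scale (\<phi> (sample i)) (cylinder i)) p =
          (\<Sum>i<length ws. if i = k then \<phi> (sample k) else 0)"
        unfolding sum_fun_apply using True k ws(1)
        by (intro sum.cong) (auto simp: fun_scale_def cylinder_def nth_eq_iff_index_eq)
      also have "\<dots> = \<phi> (sample k)" using k by simp
      also have "\<dots> = \<phi> p"
      proof (rule depth_at_mostD)
        show "depth_at_most G m \<phi>" using \<phi> by (simp add: F_space_def)
        have "prefix_word m (sample k) = prefix_word m p" using sample(2)[OF k(1)] k(2) by simp
        thus "sample k i = p i" if "i < m" for i using that unfolding prefix_word_eq_iff by blast
      qed (fact sample(1)[OF k(1)] True)+
      finally show ?thesis by simp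
    next
      case False
      thus ?thesis using \<phi> unfolding sum_fun_apply
        by (simp add: F_space_def fun_scale_def cylinder_def)
    qed
  qed
qed

text \<open>
  A path that returns to its own first \<open>m\<close> edges after \<open>n\<close> steps and then follows a fixed sample path
  agrees on its first \<open>n + m\<close> edges with a periodic path; only those edges enter the weights.
\<close>

lemma sum_cylinder_eq_closed_paths:
  assumes n: "n \<ge> 1" and \<omega>: "depth_at_most G m \<omega>" and k: "k < length ws"
  shows "(\<Sum>p'\<in>preimages G n (sample k). (\<Prod>i<n. \<omega> (\<lambda>j. p' (j + i))) * cylinder k p') =
    (\<Sum>c | closed_path G c \<and> length c = n \<and> prefix_word m (periodic c) = ws ! k.
       \<Prod>i<n. \<omega> (\<lambda>j. periodic c (j + i)))"
proof -
  let ?w = "\<lambda>p'. \<Prod>i<n. \<omega> (\<lambda>j. p' (j + i))"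
  let ?x = "sample k"
  let ?S = "{p' \<in> preimages G n ?x. prefix_word m p' = ws ! k}"
  have x: "?x \<in> paths_plus G" "prefix_word m ?x = ws ! k" using sample[OF k] by auto
  \<comment> \<open>Position \<open>i \<ge> n\<close> of \<open>p'\<close> is position
    \<open>i - n\<close> of the sample; this is below \<open>m\<close>, where the sample and
    \<open>p'\<close> coincide, so the index drops by \<open>n\<close>. Full induction covers
    periods \<open>n\<close> shorter than \<open>m\<close>, where several drops may be
    needed.\<close>
  have agree: "p' i = periodic (prefix_word n p') i" if p': "p' \<in> ?S" and "i < n + m" for p' i
    using \<open>i < n + m\<close>
  proof (induction i rule: less_induct)
    case (less i)
    show ?case
    proof (cases "i < n")
      case True
      thus ?thesis by (simp add: periodic_def prefix_word_def)
    next
      case False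
      have "p' (i - n + n) = ?x (i - n)" using p' unfolding preimages_def by blast
      hence "p' i = ?x (i - n)" using False by simp
      also have "\<dots> = p' (i - n)"
      proof -
        have "prefix_word m p' = prefix_word m ?x" using p' x(2) by simp
        moreover have "i - n < m" using less.prems False by linarith
        ultimately show ?thesis unfolding prefix_word_eq_iff by metis
      qed
      also have "\<dots> = periodic (prefix_word n p') (i - n)"
        by (rule less.IH) (use less.prems False n in linarith)+
      also have "\<dots> = periodic (prefix_word n p') i"
        using False periodic_add_length[of "prefix_word n p'" "i - n"] by (simp add: prefix_word_def)
      finally show ?thesis .
    qed
  qed
  \<comment> \<open>The inverse of taking the first \<open>n\<close> edges: the word is followed by
    the sample path.\<close>
  define ext where "ext = (\<lambda>c i. if i < n then c ! i else ?x (i - n))"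
  have ext_agree: "ext c i = periodic c i"
    if c: "length c = n" "prefix_word m (periodic c) = ws ! k" and i: "i < n + m" for c i
  proof (cases "i < n")
    case True
    thus ?thesis using c by (simp add: ext_def periodic_def)
  next
    case False
    have "prefix_word m ?x = prefix_word m (periodic c)" using c(2) x(2) by simp
    moreover have "i - n < m" using i False by linarith
    ultimately have "?x (i - n) = periodic c (i - n)" unfolding prefix_word_eq_iff by metis
    also have "\<dots> = periodic c i"
      using False c(1) periodic_add_length[of c "i - n"] by simp
    finally show ?thesis using False by (simp add: ext_def)
  qed
  have "(\<Sum>p'\<in>preimages G n ?x. ?w p' * cylinder k p') = (\<Sum>p'\<in>?S. ?w p')"
  proof (rule sum.mono_neutral_cong_right)
    show "finite (preimages G n ?x)" by (intro finite_preimages fin)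
  qed (auto simp: cylinder_def preimages_def)
  also have "\<dots> = (\<Sum>c | closed_path G c \<and> length c = n \<and> prefix_word m (periodic c) = ws ! k.
       ?w (periodic c))"
  proof (rule sum.reindex_bij_witness[where i = ext and j = "prefix_word n"])
    fix p' assume p': "p' \<in> ?S"
    let ?c = "prefix_word n p'"
    have len: "length ?c = n" by (simp add: prefix_word_def)
    have p'_path: "p' \<in> paths_plus G" using p' by (simp add: preimages_def)
    have "?c \<noteq> []" using len n by auto
    moreover have c_path: "periodic ?c \<in> paths_plus G"
      unfolding paths_plus_def mem_Collect_eq
    proof
      fix i
      have r: "i mod n < n" "Suc i mod n = Suc (i mod n) mod n"
        using n by (auto simp: mod_Suc_eq)
      have "periodic ?c i = p' (i mod n)" using r by (simp add: periodic_def prefix_word_def)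
      moreover have "periodic ?c (Suc i) = periodic ?c (Suc (i mod n))"
        unfolding periodic_def len r(2) ..
      \<comment> \<open>The index may equal \<open>n\<close>, where the word closes up. Since
        \<open>m \<ge> 1\<close> it stays below \<open>n + m\<close>, so the closing pair of the
        cycle is a consecutive pair of \<open>p'\<close>.\<close>
      moreover have "periodic ?c (Suc (i mod n)) = p' (Suc (i mod n))"
        using agree[OF p', of "Suc (i mod n)"] r(1) m by simp
      ultimately show "periodic ?c i \<in> parcs G \<and> admissible_pair (periodic ?c i) (periodic ?c (Suc i))"
        using p'_path by (simp add: paths_plus_def)
    qed
    ultimately have closed: "closed_path G ?c" using graph by (simp add: closed_path_iff_periodic)
    have "prefix_word m (periodic ?c) = prefix_word m p'"
      using agree[OF p'] by (simp add: prefix_word_eq_iff)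
    with closed len p' show "?c \<in> {c. closed_path G c \<and> length c = n \<and> prefix_word m (periodic c) = ws ! k}"
      by simp
    show "ext ?c = p'"
    proof
      fix i
      show "ext ?c i = p' i"
      proof (cases "i < n")
        case False
        have "p' (i - n + n) = ?x (i - n)" using p' unfolding preimages_def by blast
        thus ?thesis using False by (simp add: ext_def)
      qed (simp add: ext_def prefix_word_def)
    qed
    show "?w (periodic ?c) = ?w p'"
    proof (rule prod.cong[OF refl])
      fix i assume "i \<in> {..<n}"
      thus "\<omega> (\<lambda>j. periodic ?c (j + i)) = \<omega> (\<lambda>j. p' (j + i))"
        by (intro depth_at_mostD[OF \<omega>] paths_plus_shift c_path p'_path agree[OF p', symmetric]) simp
    qed
  next
    fix c assume "c \<in> {c. closed_path G c \<and> length c = n \<and> prefix_word m (periodic c) = ws ! k}"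
    hence c: "closed_path G c" "length c = n" "prefix_word m (periodic c) = ws ! k" by auto
    have c_path: "periodic c \<in> paths_plus G" using c(1) graph by (simp add: closed_path_iff_periodic)
    show "prefix_word n (ext c) = c"
      using c(2) by (auto simp: prefix_word_def ext_def intro: nth_equalityI)
    have "ext c \<in> paths_plus G"
      unfolding paths_plus_def mem_Collect_eq
    proof
      fix i
      show "ext c i \<in> parcs G \<and> admissible_pair (ext c i) (ext c (Suc i))"
      proof (cases "i < n")
        case True
        thus ?thesis
          using ext_agree[OF c(2,3), of i] ext_agree[OF c(2,3), of "Suc i"] m c_path
          by (simp add: paths_plus_def)
      next
        case False
        thus ?thesis using x(1) by (simp add: ext_def paths_plus_def Suc_diff_le)
      qed
    qed
    moreover have "prefix_word m (ext c) = ws ! k"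
      using ext_agree[OF c(2,3)] c(3) prefix_word_eq_iff[of m "ext c" "periodic c"] by simp
    ultimately show "ext c \<in> ?S" by (simp add: preimages_def ext_def)
  qed
  finally show ?thesis .
qed

lemma finite_closed_paths: "finite {c. closed_path G c \<and> length c = n}"
  by (rule finite_subset[OF _ finite_lists_length_eq[OF fin, of n]]) (auto simp: closed_path_def)

text \<open>The diagonal entry at a word collects the closed paths whose repetition begins with that
  word, and each closed path begins with exactly one. The case \<open>n = 0\<close> is left out:
  there the trace is the dimension, but no closed path has length zero.\<close>

lemma trace_transfer_op_pow:
  assumes n: "n \<ge> 1" and \<omega>: "depth_at_most G m \<omega>"
  shows "mat_trace (sample_matrix (transfer_op G \<omega>) ^\<^sub>m n) =
    (\<Sum>c | closed_path G c \<and> length c = n. \<Prod>i<n. \<omega> (\<lambda>j. periodic c (j + i)))"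
    (is "_ = sum ?g ?C")
proof -
  have "mat_trace (sample_matrix (transfer_op G \<omega>) ^\<^sub>m n) =
      (\<Sum>k<length ws. (transfer_op G \<omega> ^^ n) (cylinder k) (sample k))"
    using transfer_op_F_space[OF fin m \<omega>]
    by (intro mat_trace_sample_matrix_pow linear_transfer_op) blast
  also have "\<dots> = (\<Sum>k<length ws. \<Sum>c | c \<in> ?C \<and> prefix_word m (periodic c) = ws ! k. ?g c)"
    by (intro sum.cong refl)
      (simp add: transfer_op_funpow[OF fin sample(1)] sum_cylinder_eq_closed_paths[OF n \<omega>] conj_assoc)
  also have "\<dots> = (\<Sum>w\<in>set ws. \<Sum>c\<in>{c \<in> ?C. prefix_word m (periodic c) = w}. ?g c)"
    using sum.reindex_bij_betw[OF bij_betw_nth[OF ws(1) refl refl],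
        of "\<lambda>w. \<Sum>c\<in>{c \<in> ?C. prefix_word m (periodic c) = w}. ?g c"] by simp
  also have "\<dots> = sum ?g ?C"
  proof (rule sum.group)
    show "(\<lambda>c. prefix_word m (periodic c)) ` ?C \<subseteq> set ws"
      using graph by (auto simp: ws(2) closed_path_iff_periodic)
  qed (simp_all add: finite_closed_paths)
  finally show ?thesis .
qed

end


section \<open>Regrouping the dynamical determinant\<close>

definition birkhoff_plus :: "((nat \<Rightarrow> 'a) \<Rightarrow> complex) \<Rightarrow> nat \<Rightarrow> (nat \<Rightarrow> 'a) \<Rightarrow> complex" where
  "birkhoff_plus \<phi> n p = (\<Sum>i<n. \<phi> (\<lambda>j. p (j + i)))"

text \<open>The share of a single closed path in the trace series, with the \<open>1 / n\<close> of
  the logarithm put inside so that it becomes a function of the path alone.\<close>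

definition path_weight :: "complex \<Rightarrow> complex \<Rightarrow> ((nat \<Rightarrow> 'a) \<Rightarrow> complex) \<Rightarrow> 'a list \<Rightarrow> complex" where
  "path_weight z \<beta> \<phi> c =
     z ^ length c / of_nat (length c) * exp (- \<beta> * birkhoff_plus \<phi> (length c) (periodic c))"

section \<open>Periodic points of the two-sided shift\<close>

lemma fst_periodic_path: "fst (periodic_path c) = periodic c"
  by (simp add: periodic_path_def periodic_def fun_eq_iff)

text \<open>The left half is stored from its right end, so the edge crossing the origin is put in
  front of the repetition of \<open>rev c\<close>; the result is the repetition of the reversed
  rotated word.\<close>

lemma shift_periodic_path:
  assumes "c \<noteq> []"
  shows "shift (periodic_path c) = periodic_path (rotate1 c)"
proof -
  obtain a xs where c: "c = a # xs" using assms by (cases c) auto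
  have "shift_plus (\<lambda>i. c ! (i mod length c)) = (\<lambda>i. rotate1 c ! (i mod length (rotate1 c)))"
    using assms by (auto simp: shift_plus_def nth_rotate1 mod_Suc_eq)
  moreover have "case_nat (c ! 0) (\<lambda>i. rev c ! (i mod length c)) i = rev (rotate1 c) ! (i mod length c)" for i
  proof (cases i)
    case 0
    thus ?thesis by (simp add: c)
  next
    case (Suc k)
    show ?thesis
    proof (cases "k mod length c = length xs")
      case True
      thus ?thesis unfolding Suc by (simp add: c mod_Suc nth_append)
    next
      case False
      moreover have "k mod length c < Suc (length xs)" using c by simp
      ultimately have "k mod length c < length xs" by linarith
      thus ?thesis unfolding Suc by (simp add: c mod_Suc nth_append)
    qed
  qed
  ultimately show ?thesis
    by (simp add: shift_def periodic_path_def fun_eq_iff)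
qed

lemma shift_funpow_periodic_path:
  assumes "c \<noteq> []"
  shows "(shift ^^ k) (periodic_path c) = periodic_path (rotate k c)"
proof (induction k)
  case (Suc k)
  have "rotate k c \<noteq> []" using assms by simp
  thus ?case using Suc by (simp add: shift_periodic_path rotate_Suc)
qed simp

text \<open>A one-sided reduction constrains \<open>f\<close> only through \<open>paths G\<close>,
  so the periodic points have to be placed there. For the left half, admissibility is read backwards
  around the cycle, with position \<open>i\<close> holding the edge
  \<open>length c - 1 - i mod length c\<close> of the word.\<close>

lemma periodic_path_in_paths:
  assumes G: "pair_graph G" and c: "closed_path G c"
  shows "periodic_path c \<in> paths G"
proof -
  let ?l = "length c"
  have ne: "c \<noteq> []" and per: "periodic c \<in> paths_plus G"
    using c G by (simp_all add: closed_path_iff_periodic)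
  have left_nth: "rev c ! (i mod ?l) = periodic c (?l - 1 - i mod ?l)" for i
  proof -
    have r: "i mod ?l < ?l" using ne by simp
    show ?thesis using r by (simp add: rev_nth periodic_def)
  qed
  have arcs: "periodic c i \<in> parcs G" and adm: "admissible_pair (periodic c i) (periodic c (Suc i))" for i
    using per by (auto simp: paths_plus_def)
  have per_l: "periodic c ?l = periodic c 0"
    using periodic_add_length[of c 0] by simp
  have "admissible_pair (rev c ! (Suc i mod ?l)) (rev c ! (i mod ?l))" for i
  proof (cases "Suc (i mod ?l) = ?l")
    case True
    hence "Suc i mod ?l = 0" "?l - 1 - i mod ?l = 0" by (simp_all add: mod_Suc)
    thus ?thesis
      using adm[of "?l - 1"] ne per_l unfolding left_nth by simp
  next
    case False
    have "i mod ?l < ?l" using ne by simp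
    with False have "Suc i mod ?l = Suc (i mod ?l)" "?l - 1 - i mod ?l = Suc (?l - 1 - Suc (i mod ?l))"
      by (simp_all add: mod_Suc)
    thus ?thesis using adm unfolding left_nth by simp
  qed
  hence "snd (periodic_path c) \<in> paths_minus G"
    using arcs left_nth by (auto simp: paths_minus_def periodic_path_def)
  moreover have "admissible_pair (snd (periodic_path c) 0) (fst (periodic_path c) 0)"
    using adm[of "?l - 1"] ne per_l left_nth[of 0] by (simp add: periodic_path_def periodic_def)
  ultimately show ?thesis
    using per fst_periodic_path[of c] by (auto simp: paths_def split: prod.splits)
qed

text \<open>
  A one-sided reduction does not change sums over a full period, since these are
  invariant under the shift.
\<close>

lemma birkhoff_sum_periodic_path:
  assumes G: "pair_graph G" and red: "one_sided_reduction G f f_plus" and c: "closed_path G c"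
  shows "birkhoff_sum f (length c) (periodic_path c) = birkhoff_plus f_plus (length c) (periodic c)"
proof -
  from red obtain m\<^sub>0 where m0: "\<And>p. p \<in> paths G \<Longrightarrow> f ((shift ^^ m\<^sub>0) p) = f_plus (fst p)"
    by (auto simp: one_sided_reduction_def)
  have ne: "c \<noteq> []" using c by (auto simp: closed_path_def)
  define F where "F = (\<lambda>i. f (periodic_path (rotate i c)))"
  have F: "F (i + length c) = F i" for i
    unfolding F_def by (subst rotate_conv_mod) (simp flip: rotate_conv_mod)
  have "birkhoff_sum f (length c) (periodic_path c) = (\<Sum>i<length c. F i)"
    by (simp add: birkhoff_sum_def shift_funpow_periodic_path ne F_def)
  also have "\<dots> = (\<Sum>i<length c. F (i + m\<^sub>0))"
    using sum_periodic[where F = F and k = 1 and j = m\<^sub>0, OF F] by simp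
  also have "\<dots> = birkhoff_plus f_plus (length c) (periodic c)"
    unfolding birkhoff_plus_def
  proof (rule sum.cong[OF refl])
    fix i
    have closed: "closed_path G (rotate i c)" by (rule closed_path_rotate[OF G c])
    have "F (i + m\<^sub>0) = f ((shift ^^ m\<^sub>0) (periodic_path (rotate i c)))"
      using ne by (simp add: F_def shift_funpow_periodic_path rotate_rotate add.commute)
    also have "\<dots> = f_plus (periodic (rotate i c))"
      by (simp add: m0 periodic_path_in_paths[OF G closed] fst_periodic_path)
    also have "periodic (rotate i c) = (\<lambda>j. periodic c (j + i))"
      using ne by (intro ext periodic_rotate)
    finally show "F (i + m\<^sub>0) = f_plus (\<lambda>j. periodic c (j + i))" .
  qed
  finally show ?thesis .
qed

lemma birkhoff_plus_periodic:
  assumes "c \<noteq> []"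
  shows "birkhoff_plus \<phi> (k * length c) (periodic (rotate j c)) =
    of_nat k * birkhoff_plus \<phi> (length c) (periodic c)"
proof -
  define F where "F = (\<lambda>i. \<phi> (\<lambda>t. periodic c (t + i)))"
  have F: "F (i + length c) = F i" for i
    unfolding F_def using periodic_add_length[of c] by (simp add: add.assoc[symmetric])
  have "periodic (rotate j c) = (\<lambda>t. periodic c (t + j))"
    using assms by (intro ext periodic_rotate)
  hence "birkhoff_plus \<phi> (k * length c) (periodic (rotate j c)) = (\<Sum>i<k * length c. F (i + j))"
    by (simp add: birkhoff_plus_def F_def add.assoc)
  also have "\<dots> = of_nat k * (\<Sum>i<length c. F i)" by (rule sum_periodic[where F = F, OF F])
  finally show ?thesis by (simp add: birkhoff_plus_def F_def)
qed

text \<open>The path weight is the same for every rotation \<open>j\<close>, because a sum over full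
  periods does not depend on its starting point. The factor \<open>class_length C\<close> turns the
  division by the length of the \<open>k\<close>-th power into a division by
  \<open>k\<close>.\<close>

lemma dyn_term_eq_path_weight:
  assumes G: "pair_graph G" and red: "one_sided_reduction G f f_plus"
    and C: "C \<in> primitive_classes G" and k: "k \<ge> 1"
  shows "dyn_term q f s \<beta> k C = of_nat (class_length C) *
    path_weight (of_nat q powr (1/2 + \<i> * s)) \<beta> f_plus (concat (replicate k (rotate j (class_rep C))))"
proof -
  let ?c = "class_rep C" and ?z = "of_nat q powr (1/2 + \<i> * s)"
  have closed: "closed_path G ?c" using primitive_classes_rep(1)[OF G C] by (simp add: primitive_path_def)
  hence ne: "?c \<noteq> []" by (auto simp: closed_path_def)
  have "birkhoff_plus f_plus (k * length ?c) (periodic (concat (replicate k (rotate j ?c)))) =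
      of_nat k * birkhoff_sum f (length ?c) (periodic_path ?c)"
    using ne k by (simp add: periodic_concat_replicate birkhoff_plus_periodic
        birkhoff_sum_periodic_path[OF G red closed])
  moreover have "of_nat q powr ((1/2 + \<i> * s) * of_nat k * of_nat (length ?c)) = ?z ^ (k * length ?c)"
  proof (cases "q = 0")
    case False
    have "exp ((1/2 + \<i> * s) * of_nat k * of_nat (length ?c) * Ln (of_nat q)) =
        exp (of_nat (k * length ?c) * ((1/2 + \<i> * s) * Ln (of_nat q)))"
      by (simp add: mult_ac)
    thus ?thesis using False unfolding exp_of_nat_mult by (simp add: powr_def)
  \<comment> \<open>For \<open>q = 0\<close> both sides vanish: \<open>powr\<close> is
    \<open>0\<close> at base \<open>0\<close>, and the exponent on the right is positive.\<close>
  qed (use ne k in \<open>simp add: power_0_left\<close>)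
  ultimately show ?thesis
    using ne k by (simp add: dyn_term_def path_weight_def class_length_def length_concat_replicate
        field_simps)
qed

text \<open>All rotations in the finite fibre over \<open>(k, C)\<close> receive the same value, so
  over a fibre the norms add up to the norm of the sum. This makes absolute summability equivalent
  on the two sides; the values then agree by summing out the fibres.\<close>

lemma
  fixes h :: "nat \<Rightarrow> 'v edge list set \<Rightarrow> complex" and g :: "'v edge list \<Rightarrow> complex"
  assumes G: "pair_graph G"
    and h: "\<And>k C j. k \<ge> 1 \<Longrightarrow> C \<in> primitive_classes G \<Longrightarrow>
      h k C = of_nat (class_length C) * g (concat (replicate k (rotate j (class_rep C))))"
  shows abs_summable_primitive_classes_iff:
      "(\<lambda>(k, C). norm (h k C)) summable_on ({1..} \<times> primitive_classes G) \<longleftrightarrow>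
        (\<lambda>c. norm (g c)) summable_on {c. closed_path G c}"
    and infsum_primitive_classes:
      "(\<lambda>c. norm (g c)) summable_on {c. closed_path G c} \<Longrightarrow>
        (\<Sum>\<^sub>\<infinity>k\<in>{1..}. \<Sum>\<^sub>\<infinity>C\<in>primitive_classes G. h k C) = infsum g {c. closed_path G c}"
proof -
  define A where "A = {1 :: nat..} \<times> primitive_classes G"
  define B where "B = (\<lambda>(k :: nat, C :: 'v edge list set). {..<class_length C})"
  define b where "b = (\<lambda>((k, C), j). concat (replicate k (rotate j (class_rep C))) :: 'v edge list)"
  define h' where "h' = (\<lambda>(k, C). h k C)"
  have bij: "bij_betw b (Sigma A B) {c. closed_path G c}"
    using closed_paths_bij_betw[OF G] unfolding A_def B_def b_def .
  have pos: "class_length C > 0" if "C \<in> primitive_classes G" for C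
    using primitive_classes_rep(1)[OF G that]
    by (auto simp: class_length_def primitive_path_def closed_path_def)
  have sum_B: "(\<Sum>j\<in>B x. g (b (x, j))) = h' x" "(\<Sum>j\<in>B x. norm (g (b (x, j)))) = norm (h' x)"
    if "x \<in> A" for x
  proof -
    obtain k C where x: "x = (k, C)" by (cases x)
    have C: "C \<in> primitive_classes G" "k \<ge> 1" using that x by (auto simp: A_def)
    have g: "g (concat (replicate k (rotate j (class_rep C)))) = h k C / of_nat (class_length C)" for j
      using h[OF C(2,1), of j] pos[OF C(1)] by simp
    show "(\<Sum>j\<in>B x. g (b (x, j))) = h' x" "(\<Sum>j\<in>B x. norm (g (b (x, j)))) = norm (h' x)"
      using pos[OF C(1)] by (simp_all add: x g norm_divide B_def b_def h'_def)
  qed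
  have fin: "finite (B x)" for x by (cases x) (simp add: B_def)
  have "(\<lambda>c. norm (g c)) summable_on {c. closed_path G c} \<longleftrightarrow> (\<lambda>x. norm (g (b x))) summable_on Sigma A B"
    using summable_on_reindex_bij_betw[OF bij, of "\<lambda>c. norm (g c)"] by simp
  also have "\<dots> \<longleftrightarrow> (\<lambda>x. norm (\<Sum>j\<in>B x. norm (g (b (x, j))))) summable_on A"
    unfolding Infinite_Sum.abs_summable_on_Sigma_iff using fin by simp
  also have "\<dots> \<longleftrightarrow> (\<lambda>x. norm (h' x)) summable_on A"
    by (rule summable_on_cong) (simp add: sum_B(2))
  also have "\<dots> \<longleftrightarrow> (\<lambda>(k, C). norm (h k C)) summable_on A"
    by (simp add: h'_def case_prod_unfold)
  finally have iff: "(\<lambda>c. norm (g c)) summable_on {c. closed_path G c} \<longleftrightarrow> (\<lambda>(k, C). norm (h k C)) summable_on A" .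
  thus "(\<lambda>(k, C). norm (h k C)) summable_on ({1..} \<times> primitive_classes G) \<longleftrightarrow>
      (\<lambda>c. norm (g c)) summable_on {c. closed_path G c}"
    unfolding A_def ..
  assume g: "(\<lambda>c. norm (g c)) summable_on {c. closed_path G c}"
  hence "(\<lambda>x. norm (g (b x))) summable_on Sigma A B"
    using summable_on_reindex_bij_betw[OF bij, of "\<lambda>c. norm (g c)"] by simp
  hence gb: "(\<lambda>x. g (b x)) summable_on Sigma A B" by (rule Infinite_Sum.abs_summable_summable)
  have "(\<lambda>x. norm (h' x)) summable_on A" using iff g by (simp add: h'_def case_prod_unfold)
  hence "h' summable_on A" by (rule Infinite_Sum.abs_summable_summable)
  hence "(\<Sum>\<^sub>\<infinity>k\<in>{1..}. \<Sum>\<^sub>\<infinity>C\<in>primitive_classes G. h k C) = infsum h' A"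
    using infsum_Sigma_banach[of h' "{1..}" "\<lambda>_. primitive_classes G"] by (simp add: A_def h'_def)
  also have "\<dots> = (\<Sum>\<^sub>\<infinity>x\<in>A. \<Sum>\<^sub>\<infinity>j\<in>B x. g (b (x, j)))"
    by (rule infsum_cong) (simp only: sum_B(1) infsum_finite[OF fin])
  also have "\<dots> = infsum (\<lambda>x. g (b x)) (Sigma A B)"
    by (rule infsum_Sigma_banach[OF gb])
  also have "\<dots> = infsum g {c. closed_path G c}"
    by (rule infsum_reindex_bij_betw[OF bij])
  finally show "(\<Sum>\<^sub>\<infinity>k\<in>{1..}. \<Sum>\<^sub>\<infinity>C\<in>primitive_classes G. h k C) = infsum g {c. closed_path G c}" .
qed

text \<open>Passes from unordered sums over closed paths to ordinary series over their lengths. The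
  equivalence is stated for norms, because values may cancel inside a level.\<close>

lemma
  fixes g :: "'a \<Rightarrow> 'b::banach" and l :: "'a \<Rightarrow> nat"
  assumes fin: "\<And>n. finite {a \<in> A. l a = n}"
  shows abs_summable_on_level_sets_iff:
      "(\<lambda>a. norm (g a)) summable_on A \<longleftrightarrow> summable (\<lambda>n. \<Sum>a | a \<in> A \<and> l a = n. norm (g a))"
    and infsum_level_sets:
      "(\<lambda>a. norm (g a)) summable_on A \<Longrightarrow> infsum g A = (\<Sum>n. \<Sum>a | a \<in> A \<and> l a = n. g a)"
    and summable_norm_level_sets:
      "(\<lambda>a. norm (g a)) summable_on A \<Longrightarrow> summable (\<lambda>n. norm (\<Sum>a | a \<in> A \<and> l a = n. g a))"
proof -
  define B where "B = (\<lambda>n. {a \<in> A. l a = n})"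
  have finB: "finite (B n)" for n using fin by (simp add: B_def)
  have bij: "bij_betw snd (Sigma UNIV B) A"
    by (rule bij_betwI[where g = "\<lambda>a. (l a, a)"]) (auto simp: B_def)
  have "(\<lambda>a. norm (g a)) summable_on A \<longleftrightarrow> (\<lambda>x. norm (g (snd x))) summable_on Sigma UNIV B"
    by (rule summable_on_reindex_bij_betw[OF bij, of "\<lambda>a. norm (g a)", symmetric])
  also have "\<dots> \<longleftrightarrow> (\<lambda>n. norm (\<Sum>a\<in>B n. norm (g a))) summable_on UNIV"
    unfolding Infinite_Sum.abs_summable_on_Sigma_iff using finB by simp
  also have "\<dots> \<longleftrightarrow> summable (\<lambda>n. \<Sum>a\<in>B n. norm (g a))"
    unfolding real_norm_def abs_of_nonneg[OF sum_nonneg[OF norm_ge_zero]]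
    by (rule summable_on_UNIV_nonneg_real_iff) (rule sum_nonneg[OF norm_ge_zero])
  finally have iff: "(\<lambda>a. norm (g a)) summable_on A \<longleftrightarrow> summable (\<lambda>n. \<Sum>a\<in>B n. norm (g a))" .
  thus "(\<lambda>a. norm (g a)) summable_on A \<longleftrightarrow> summable (\<lambda>n. \<Sum>a | a \<in> A \<and> l a = n. norm (g a))"
    by (simp only: B_def)
  assume g: "(\<lambda>a. norm (g a)) summable_on A"
  have summ: "summable (\<lambda>n. norm (\<Sum>a\<in>B n. g a))"
    using g unfolding iff
    by (rule summable_comparison_test'[where N = 0]) (simp add: sum_nonneg norm_sum)
  thus "summable (\<lambda>n. norm (\<Sum>a | a \<in> A \<and> l a = n. g a))" by (simp only: B_def)
  have "(\<lambda>x. g (snd x)) summable_on Sigma UNIV B"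
    by (rule Infinite_Sum.abs_summable_summable
        [OF g[folded summable_on_reindex_bij_betw[OF bij, of "\<lambda>a. norm (g a)"]]])
  hence "infsum (\<lambda>x. g (snd x)) (Sigma UNIV B) = (\<Sum>\<^sub>\<infinity>n. \<Sum>\<^sub>\<infinity>a\<in>B n. g a)"
    using infsum_Sigma_banach[of "\<lambda>x. g (snd x)" UNIV B] by simp
  hence "infsum g A = (\<Sum>\<^sub>\<infinity>n. \<Sum>a\<in>B n. g a)"
    using infsum_reindex_bij_betw[OF bij, of g] finB by simp
  also have "\<dots> = (\<Sum>n. \<Sum>a\<in>B n. g a)"
    using norm_summable_imp_has_sum[OF summ summable_sums[OF summable_norm_cancel[OF summ]]]
    by (rule infsumI)
  finally show "infsum g A = (\<Sum>n. \<Sum>a | a \<in> A \<and> l a = n. g a)" by (simp only: B_def)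
qed

section \<open>The dynamical determinant as a matrix determinant\<close>

context prefix_words
begin

lemma depth_at_most_exp:
  "depth_at_most G m \<phi> \<Longrightarrow> depth_at_most G m (\<lambda>p. exp (- \<beta> * \<phi> p))"
  unfolding depth_at_most_def by metis

lemma sum_path_weight_eq_trace:
  assumes \<phi>: "depth_at_most G m \<phi>"
  shows "(\<Sum>c | closed_path G c \<and> length c = n. path_weight z \<beta> \<phi> c) =
    mat_trace (sample_matrix (transfer_op G (\<lambda>p. exp (- \<beta> * \<phi> p))) ^\<^sub>m n) * z ^ n / of_nat n"
proof (cases "n = 0")
  case True
  \<comment> \<open>Both sides are zero here: there is no closed path of length zero, and the right
    side is a division by zero.\<close>
  have "{c. closed_path G c \<and> length c = n} = {}" using True by (auto simp: closed_path_def)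
  thus ?thesis unfolding True by (simp only: sum.empty) simp
next
  case False
  have "(\<Sum>c | closed_path G c \<and> length c = n. path_weight z \<beta> \<phi> c) =
      (\<Sum>c | closed_path G c \<and> length c = n.
        (\<Prod>i<n. exp (- \<beta> * \<phi> (\<lambda>j. periodic c (j + i)))) * z ^ n / of_nat n)"
    by (intro sum.cong refl)
      (simp add: path_weight_def birkhoff_plus_def sum_distrib_left exp_sum flip: sum_negf)
  also have "\<dots> = mat_trace (sample_matrix (transfer_op G (\<lambda>p. exp (- \<beta> * \<phi> p))) ^\<^sub>m n) * z ^ n / of_nat n"
    using trace_transfer_op_pow[OF _ depth_at_most_exp[OF \<phi>], of n \<beta>] False
    by (simp add: sum_distrib_right sum_divide_distrib)
  finally show ?thesis .
qed

lemma abs_conv_domain_iff: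
  assumes "one_sided_reduction G f f_plus"
  shows "(s, \<beta>) \<in> abs_conv_domain G q f \<longleftrightarrow>
    (\<lambda>c. norm (path_weight (of_nat q powr (1/2 + \<i> * s)) \<beta> f_plus c)) summable_on {c. closed_path G c}"
  using abs_summable_primitive_classes_iff[OF graph dyn_term_eq_path_weight[OF graph assms]]
  by (simp add: abs_conv_domain_def)

text \<open>Absolute convergence is assumed instead of the half plane, because the continuation has
  to agree with the dynamical determinant wherever its series converges absolutely.\<close>

lemma dyn_det_eq_det:
  assumes red: "one_sided_reduction G f f_plus" and depth: "depth_at_most G m f_plus"
    and conv: "(s, \<beta>) \<in> abs_conv_domain G q f"
  shows "dyn_det G q f s \<beta> = Determinant.det (1\<^sub>m (length ws) -
    (of_nat q powr (1/2 + \<i> * s)) \<cdot>\<^sub>m sample_matrix (transfer_op G (\<lambda>p. exp (- \<beta> * f_plus p))))"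
proof -
  let ?z = "of_nat q powr (1/2 + \<i> * s)"
  let ?M = "sample_matrix (transfer_op G (\<lambda>p. exp (- \<beta> * f_plus p)))"
  let ?t = "\<lambda>n. mat_trace (?M ^\<^sub>m n) * ?z ^ n / of_nat n"
  have conv': "(\<lambda>c. norm (path_weight ?z \<beta> f_plus c)) summable_on {c. closed_path G c}"
    using conv unfolding abs_conv_domain_iff[OF red] .
  have fin: "finite {c \<in> {c. closed_path G c}. length c = n}" for n
    using finite_closed_paths by simp
  have level: "(\<Sum>c | c \<in> {c. closed_path G c} \<and> length c = n. path_weight ?z \<beta> f_plus c) = ?t n" for n
    using sum_path_weight_eq_trace[OF depth, of ?z \<beta> n] by simp
  have "summable (\<lambda>n. norm (?t n))"
    using summable_norm_level_sets[OF fin conv'] unfolding level .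
  hence "exp (- (\<Sum>n. ?t n)) = Determinant.det (1\<^sub>m (length ws) - ?z \<cdot>\<^sub>m ?M)"
    by (rule exp_trace_sum_eq_det[OF sample_matrix_carrier])
  moreover have "(\<Sum>\<^sub>\<infinity>k\<in>{1..}. \<Sum>\<^sub>\<infinity>C\<in>primitive_classes G. dyn_term q f s \<beta> k C) = (\<Sum>n. ?t n)"
  proof -
    have "(\<Sum>\<^sub>\<infinity>k\<in>{1..}. \<Sum>\<^sub>\<infinity>C\<in>primitive_classes G. dyn_term q f s \<beta> k C) =
        infsum (path_weight ?z \<beta> f_plus) {c. closed_path G c}"
      by (rule infsum_primitive_classes[OF graph dyn_term_eq_path_weight[OF graph red] conv'])
    also have "\<dots> = (\<Sum>n. ?t n)"
      unfolding infsum_level_sets[OF fin conv'] level ..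
    finally show ?thesis .
  qed
  ultimately show ?thesis by (simp add: dyn_det_def)
qed

end


section \<open>Convergence, holomorphy and the main result\<close>

lemma card_admissible_successors:
  assumes G: "pair_graph G" and reg: "regular_graph (q + 1) G" and e: "e \<in> parcs G"
  shows "card {b \<in> parcs G. admissible_pair e b} = q"
proof -
  interpret pair_graph G by (rule G)
  let ?O = "out_arcs (with_proj G) (snd e)"
  have O: "?O = {b \<in> parcs G. fst b = snd e}" by (auto simp: out_arcs_def)
  have "snd e \<in> pverts G" using e by (cases e) (auto dest: in_arcsD2)
  hence card: "card ?O = q + 1" using reg by (simp add: regular_graph_def out_degree_def)
  \<comment> \<open>The reverse edge is the single forbidden successor; symmetry puts it among the
    \<open>q + 1\<close> outgoing edges.\<close>
  have "prod.swap e \<in> parcs G"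
    using e pair_sym_arcs by (cases e) (auto simp: symmetric_def dest: symD)
  hence "prod.swap e \<in> ?O" unfolding O by simp
  moreover have "{b \<in> parcs G. admissible_pair e b} = ?O - {prod.swap e}"
    unfolding O by (auto simp: admissible_pair_def)
  ultimately show ?thesis using card by (simp add: card_Diff_singleton)
qed

lemma card_admissible_lists:
  assumes G: "pair_graph G" and reg: "regular_graph (q + 1) G"
  shows "finite {c. length c = Suc n \<and> set c \<subseteq> parcs G \<and> successively admissible_pair c} \<and>
    card {c. length c = Suc n \<and> set c \<subseteq> parcs G \<and> successively admissible_pair c} \<le> card (parcs G) * q ^ n"
proof (induction n)
  case 0
  interpret pair_graph G by (rule G)
  have "{c. length c = Suc 0 \<and> set c \<subseteq> parcs G \<and> successively admissible_pair c} = (\<lambda>e. [e]) ` parcs G"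
    by (auto simp: length_Suc_conv)
  thus ?case by (simp add: card_image_le)
next
  case (Suc n)
  interpret pair_graph G by (rule G)
  let ?A = "\<lambda>n. {c. length c = Suc n \<and> set c \<subseteq> parcs G \<and> successively admissible_pair c}"
  let ?S = "\<lambda>c. {b \<in> parcs G. admissible_pair (last c) b}"
  have sub: "?A (Suc n) \<subseteq> (\<lambda>(c, b). c @ [b]) ` Sigma (?A n) ?S"
  proof
    fix d assume d: "d \<in> ?A (Suc n)"
    then obtain c b where cb: "d = c @ [b]" by (cases d rule: rev_cases) auto
    have "(c, b) \<in> Sigma (?A n) ?S"
      using d unfolding cb by (auto simp: successively_append_iff)
    thus "d \<in> (\<lambda>(c, b). c @ [b]) ` Sigma (?A n) ?S" unfolding cb by force
  qed
  have fin: "finite (Sigma (?A n) ?S)" using Suc pair_finite_arcs by auto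
  have "card (?A (Suc n)) \<le> card (Sigma (?A n) ?S)"
    using surj_card_le[OF fin sub] .
  also have "\<dots> = (\<Sum>c\<in>?A n. card (?S c))"
    using Suc pair_finite_arcs by (intro card_SigmaI) auto
  also have "\<dots> = (\<Sum>c\<in>?A n. q)"
  proof (rule sum.cong[OF refl])
    fix c assume c: "c \<in> ?A n"
    hence "c \<noteq> []" by auto
    hence "last c \<in> parcs G" using c last_in_set by blast
    thus "card (?S c) = q" by (rule card_admissible_successors[OF G reg])
  qed
  also have "\<dots> \<le> card (parcs G) * q ^ n * q" using Suc by simp
  finally have "card (?A (Suc n)) \<le> card (parcs G) * q ^ Suc n" by (simp add: mult_ac)
  moreover have "finite (?A (Suc n))" using finite_subset[OF sub finite_imageI[OF fin]] .
  ultimately show ?case by blast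
qed

lemma card_closed_paths_le:
  assumes G: "pair_graph G" and reg: "regular_graph (q + 1) G" and q: "q \<ge> 1"
  shows "card {c. closed_path G c \<and> length c = n} \<le> card (parcs G) * q ^ n"
proof (cases n)
  case 0
  hence "{c. closed_path G c \<and> length c = n} = {}" by (auto simp: closed_path_def)
  thus ?thesis by (simp only: card.empty)
next
  case (Suc k)
  let ?A = "{c. length c = Suc k \<and> set c \<subseteq> parcs G \<and> successively admissible_pair c}"
  have "card {c. closed_path G c \<and> length c = n} \<le> card ?A"
    using card_admissible_lists[OF G reg, of k] Suc
    by (intro card_mono) (auto simp: closed_path_def)
  also have "\<dots> \<le> card (parcs G) * q ^ k" using card_admissible_lists[OF G reg, of k] by blast
  also have "\<dots> \<le> card (parcs G) * q ^ n"
    using q Suc by (intro mult_left_mono power_increasing) auto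
  finally show ?thesis .
qed

section \<open>Absolute convergence in the half plane\<close>

context prefix_words
begin

text \<open>Finite depth leaves only the values at the samples, so the set of norms is finite and
  \<open>SUP\<close> is a genuine upper bound; for an unbounded set of reals it would carry no
  information.\<close>

lemma norm_le_sup_norm_plus:
  assumes \<phi>: "depth_at_most G m \<phi>" and p: "p \<in> paths_plus G"
  shows "norm (\<phi> p) \<le> sup_norm_plus G \<phi>"
proof -
  have "(\<lambda>p. norm (\<phi> p)) ` paths_plus G \<subseteq> (\<lambda>i. norm (\<phi> (sample i))) ` {..<length ws}"
  proof
    fix r assume "r \<in> (\<lambda>p. norm (\<phi> p)) ` paths_plus G"
    then obtain p where p: "p \<in> paths_plus G" "r = norm (\<phi> p)" by blast
    obtain i where i: "i < length ws" "prefix_word m p = ws ! i" by (rule word_index[OF p(1)])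
    hence "prefix_word m p = prefix_word m (sample i)" using sample(2) by simp
    hence "\<phi> p = \<phi> (sample i)"
      unfolding prefix_word_eq_iff by (intro depth_at_mostD[OF \<phi> p(1) sample(1)[OF i(1)]]) blast
    thus "r \<in> (\<lambda>i. norm (\<phi> (sample i))) ` {..<length ws}" using p(2) i(1) by auto
  qed
  hence "finite ((\<lambda>p. norm (\<phi> p)) ` paths_plus G)" by (rule finite_subset) simp
  thus ?thesis unfolding sup_norm_plus_def
    by (intro cSUP_upper p bdd_above_finite)
qed

text \<open>The exponential is controlled by \<open>Re w \<le> norm w\<close>, with one sup norm for
  each term of the Birkhoff sum, and the division by the length only makes the weight
  smaller.\<close>

lemma norm_path_weight_le:
  assumes \<phi>: "depth_at_most G m \<phi>" and c: "closed_path G c"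
  shows "norm (path_weight z \<beta> \<phi> c) \<le> (norm z * exp (norm \<beta> * sup_norm_plus G \<phi>)) ^ length c"
proof -
  let ?n = "length c" and ?S = "sup_norm_plus G \<phi>"
  have per: "periodic c \<in> paths_plus G" using c graph by (simp add: closed_path_iff_periodic)
  have "norm (birkhoff_plus \<phi> ?n (periodic c)) \<le> (\<Sum>i<?n. ?S)"
    unfolding birkhoff_plus_def by (intro sum_norm_le norm_le_sup_norm_plus \<phi> paths_plus_shift per)
  hence "norm \<beta> * norm (birkhoff_plus \<phi> ?n (periodic c)) \<le> norm \<beta> * (of_nat ?n * ?S)"
    by (intro mult_left_mono) simp_all
  hence "Re (- \<beta> * birkhoff_plus \<phi> ?n (periodic c)) \<le> of_nat ?n * (norm \<beta> * ?S)"
    using complex_Re_le_cmod[of "- \<beta> * birkhoff_plus \<phi> ?n (periodic c)"]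
    by (simp add: norm_mult mult_ac)
  hence "norm (exp (- \<beta> * birkhoff_plus \<phi> ?n (periodic c))) \<le> exp (norm \<beta> * ?S) ^ ?n"
    unfolding norm_exp_eq_Re exp_of_nat_mult[symmetric] by (rule exp_le_cancel_iff[THEN iffD2])
  moreover have "norm (z ^ ?n / of_nat ?n) \<le> norm z ^ ?n"
  proof -
    have "c \<noteq> []" using c by (auto simp: closed_path_def)
    thus ?thesis
      using divide_left_mono[of 1 "real ?n" "norm z ^ ?n"] by (simp add: norm_divide norm_power)
  qed
  ultimately show ?thesis
    unfolding path_weight_def norm_mult power_mult_distrib by (intro mult_mono) simp_all
qed

lemma abs_conv_domainI:
  assumes red: "one_sided_reduction G f f_plus" and depth: "depth_at_most G m f_plus"
    and q: "q > 1" and reg: "regular_graph (q + 1) G"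
    and s: "Im s > 3/2 + norm \<beta> * sup_norm_plus G f_plus / ln (real q)"
  shows "(s, \<beta>) \<in> abs_conv_domain G q f"
proof -
  let ?z = "of_nat q powr (1/2 + \<i> * s) :: complex"
  let ?S = "sup_norm_plus G f_plus"
  \<comment> \<open>Ratio of the dominating geometric series: \<open>q\<close> bounds the growth of
    the number of closed paths, the rest bounds the weight per edge. As \<open>norm ?z\<close> is
    \<open>q powr (1/2 - Im s)\<close>, the total exponent of \<open>q\<close> is
    \<open>3/2 - Im s\<close>, one half from \<open>z\<close> and one from the counting. The
    condition \<open>r < 1\<close> is exactly the assumed half plane.\<close>
  define r where "r = real q * (norm ?z * exp (norm \<beta> * ?S))"
  have lnq: "ln (real q) > 0" using q by simp
  have "norm ?z = real q powr (1/2 - Im s)"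
    by (subst norm_powr_real_powr) simp_all
  hence "r = exp (ln (real q)) * (exp ((1/2 - Im s) * ln (real q)) * exp (norm \<beta> * ?S))"
    using q by (simp add: r_def powr_def)
  also have "\<dots> = exp ((3/2 - Im s) * ln (real q) + norm \<beta> * ?S)"
    by (simp add: exp_add[symmetric] algebra_simps)
  also have "\<dots> < 1"
  proof -
    have "norm \<beta> * ?S / ln (real q) < Im s - 3/2" using s by linarith
    hence "norm \<beta> * ?S < (Im s - 3/2) * ln (real q)" using lnq by (simp add: pos_divide_less_eq)
    thus ?thesis by (simp add: algebra_simps)
  qed
  finally have r1: "r < 1" .
  have r0: "r \<ge> 0" by (simp add: r_def)
  have "summable (\<lambda>n. real (card (parcs G)) * r ^ n)"
    using r0 r1 by (intro summable_mult summable_geometric) simp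
  hence "summable (\<lambda>n. \<Sum>c | c \<in> {c. closed_path G c} \<and> length c = n. norm (path_weight ?z \<beta> f_plus c))"
  proof (rule summable_comparison_test'[where N = 0])
    fix n
    let ?C = "{c. c \<in> {c. closed_path G c} \<and> length c = n}"
    have "(\<Sum>c\<in>?C. norm (path_weight ?z \<beta> f_plus c)) \<le>
        of_nat (card ?C) * (norm ?z * exp (norm \<beta> * ?S)) ^ n"
      using norm_path_weight_le[OF depth] by (intro sum_bounded_above) auto
    also have "\<dots> \<le> (real (card (parcs G)) * real q ^ n) * (norm ?z * exp (norm \<beta> * ?S)) ^ n"
    proof (rule mult_right_mono)
      show "real (card ?C) \<le> real (card (parcs G)) * real q ^ n"
        using card_closed_paths_le[OF graph reg, of n] q
        by (simp flip: of_nat_mult of_nat_power)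
    qed simp
    also have "\<dots> = real (card (parcs G)) * r ^ n" by (simp add: r_def power_mult_distrib)
    finally show "norm (\<Sum>c\<in>?C. norm (path_weight ?z \<beta> f_plus c)) \<le> real (card (parcs G)) * r ^ n"
      by (simp add: sum_nonneg)
  qed
  thus ?thesis
    unfolding abs_conv_domain_iff[OF red]
    by (subst abs_summable_on_level_sets_iff[where l = length]) (use finite_closed_paths in simp_all)
qed

end

section \<open>Closure properties of holomorphy in two complex variables\<close>

lemma holomorphic2_on_const: "holomorphic2_on (\<lambda>_. c) S"
  unfolding holomorphic2_on_def
  by (intro ballI exI[of _ 0]) (auto intro!: derivative_eq_intros)

lemma holomorphic2_on_fst: "holomorphic2_on fst S"
  unfolding holomorphic2_on_def
  by (intro ballI exI[of _ 1] exI[of _ 0]) (auto intro!: derivative_eq_intros)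

lemma holomorphic2_on_snd: "holomorphic2_on snd S"
  unfolding holomorphic2_on_def
  by (intro ballI exI[of _ 0] exI[of _ 1]) (auto intro!: derivative_eq_intros)

lemma holomorphic2_on_add:
  assumes "holomorphic2_on f S" "holomorphic2_on g S"
  shows "holomorphic2_on (\<lambda>p. f p + g p) S"
  unfolding holomorphic2_on_def
proof
  fix p assume "p \<in> S"
  with assms obtain a b c d where
    "(f has_derivative (\<lambda>(h, k). a * h + b * k)) (at p within S)"
    "(g has_derivative (\<lambda>(h, k). c * h + d * k)) (at p within S)"
    unfolding holomorphic2_on_def by meson
  from has_derivative_add[OF this]
  have "((\<lambda>p. f p + g p) has_derivative (\<lambda>(h, k). (a + c) * h + (b + d) * k)) (at p within S)"
    by (rule has_derivative_eq_rhs) (auto simp: algebra_simps)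
  thus "\<exists>a b. ((\<lambda>p. f p + g p) has_derivative (\<lambda>(h, k). a * h + b * k)) (at p within S)" by blast
qed

lemma holomorphic2_on_mult:
  assumes "holomorphic2_on f S" "holomorphic2_on g S"
  shows "holomorphic2_on (\<lambda>p. f p * g p) S"
  unfolding holomorphic2_on_def
proof
  fix p assume "p \<in> S"
  with assms obtain a b c d where
    "(f has_derivative (\<lambda>(h, k). a * h + b * k)) (at p within S)"
    "(g has_derivative (\<lambda>(h, k). c * h + d * k)) (at p within S)"
    unfolding holomorphic2_on_def by meson
  from has_derivative_mult[OF this]
  have "((\<lambda>p. f p * g p) has_derivative
      (\<lambda>(h, k). (f p * c + a * g p) * h + (f p * d + b * g p) * k)) (at p within S)"
    by (rule has_derivative_eq_rhs) (auto simp: algebra_simps)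
  thus "\<exists>a b. ((\<lambda>p. f p * g p) has_derivative (\<lambda>(h, k). a * h + b * k)) (at p within S)" by blast
qed

lemma holomorphic2_on_exp:
  assumes "holomorphic2_on f S"
  shows "holomorphic2_on (\<lambda>p. exp (f p)) S"
  unfolding holomorphic2_on_def
proof
  fix p assume "p \<in> S"
  with assms obtain a b where f: "(f has_derivative (\<lambda>(h, k). a * h + b * k)) (at p within S)"
    unfolding holomorphic2_on_def by meson
  have "(exp has_derivative (*) (exp (f p))) (at (f p))"
    using DERIV_exp[of "f p"] by (simp add: has_field_derivative_def)
  from has_derivative_compose[OF f this]
  have "((\<lambda>p. exp (f p)) has_derivative (\<lambda>(h, k). (exp (f p) * a) * h + (exp (f p) * b) * k)) (at p within S)"
    by (rule has_derivative_eq_rhs) (auto simp: algebra_simps)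
  thus "\<exists>a b. ((\<lambda>p. exp (f p)) has_derivative (\<lambda>(h, k). a * h + b * k)) (at p within S)" by blast
qed

lemma holomorphic2_on_sum:
  "(\<And>i. i \<in> I \<Longrightarrow> holomorphic2_on (f i) S) \<Longrightarrow> holomorphic2_on (\<lambda>p. \<Sum>i\<in>I. f i p) S"
  by (induction I rule: infinite_finite_induct)
    (simp_all add: holomorphic2_on_const holomorphic2_on_add)

lemma holomorphic2_on_prod:
  "(\<And>i. i \<in> I \<Longrightarrow> holomorphic2_on (f i) S) \<Longrightarrow> holomorphic2_on (\<lambda>p. \<Prod>i\<in>I. f i p) S"
  by (induction I rule: infinite_finite_induct)
    (simp_all add: holomorphic2_on_const holomorphic2_on_mult)

lemma holomorphic2_on_diff:
  assumes "holomorphic2_on f S" "holomorphic2_on g S"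
  shows "holomorphic2_on (\<lambda>p. f p - g p) S"
  using holomorphic2_on_add[OF assms(1) holomorphic2_on_mult[OF holomorphic2_on_const[of "- 1"] assms(2)]]
  by simp

text \<open>The Leibniz formula makes the determinant a polynomial in the entries.\<close>

lemma holomorphic2_on_det:
  assumes "\<And>i j. i < n \<Longrightarrow> j < n \<Longrightarrow> holomorphic2_on (\<lambda>p. A p $$ (i, j)) S"
    and "\<And>p. A p \<in> carrier_mat n n"
  shows "holomorphic2_on (\<lambda>p. Determinant.det (A p)) S"
  unfolding det_def'[OF assms(2)]
  by (intro holomorphic2_on_sum holomorphic2_on_mult holomorphic2_on_const holomorphic2_on_prod assms(1))
    (auto dest: permutes_in_image)

text \<open>In each entry \<open>s\<close> occurs only in \<open>q powr (1/2 + \<i> * s)\<close>, an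
  exponential because the base is nonzero, and \<open>\<beta>\<close> only in exponentials of its
  multiples.\<close>

lemma (in prefix_words) holomorphic2_on_det_transfer_op:
  assumes q: "q > 1"
  shows "holomorphic2_on (\<lambda>(s, \<beta>). Determinant.det (1\<^sub>m (length ws) -
    (of_nat q powr (1/2 + \<i> * s)) \<cdot>\<^sub>m sample_matrix (transfer_op G (\<lambda>p. exp (- \<beta> * f_plus p))))) S"
  unfolding case_prod_unfold
proof (rule holomorphic2_on_det[where n = "length ws"])
  fix i j assume ij: "i < length ws" "j < length ws"
  have powr: "holomorphic2_on (\<lambda>p. of_nat q powr (1/2 + \<i> * fst p)) S"
  proof -
    have "holomorphic2_on (\<lambda>p. exp ((1/2 + \<i> * fst p) * Ln (of_nat q))) S"
      by (intro holomorphic2_on_exp holomorphic2_on_mult holomorphic2_on_add holomorphic2_on_const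
          holomorphic2_on_fst)
    thus ?thesis using q by (simp add: powr_def)
  qed
  have "holomorphic2_on (\<lambda>p. (if i = j then 1 else 0) - of_nat q powr (1/2 + \<i> * fst p) *
      (\<Sum>p'\<in>{p' \<in> paths_plus G. shift_plus p' = sample i}.
         exp (- 1 * snd p * f_plus p') * cylinder j p')) S"
    by (intro holomorphic2_on_diff holomorphic2_on_sum holomorphic2_on_mult holomorphic2_on_exp
        holomorphic2_on_const holomorphic2_on_snd powr)
  thus "holomorphic2_on (\<lambda>p. (1\<^sub>m (length ws) - (of_nat q powr (1/2 + \<i> * fst p)) \<cdot>\<^sub>m
      sample_matrix (transfer_op G (\<lambda>p'. exp (- snd p * f_plus p')))) $$ (i, j)) S"
    using ij sample(1)[OF ij(1)] by (simp add: sample_matrix_def transfer_op_def)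
qed (intro minus_carrier_mat smult_carrier_mat sample_matrix_carrier)

theorem proposition4p14:
  fixes G :: "'v pair_pre_digraph" and q m :: nat
    and f :: "(nat \<Rightarrow> 'v edge) \<times> (nat \<Rightarrow> 'v edge) \<Rightarrow> complex"
    and f_plus :: "(nat \<Rightarrow> 'v edge) \<Rightarrow> complex"
  assumes "q > 1"
    and "pair_graph G"
    and "Digraph_Component.connected (with_proj G)"
    and "regular_graph (q + 1) G"
    and "locally_constant (paths_topology G) f"
    and "locally_constant (paths_plus_topology G) f_plus"
    and "one_sided_reduction G f f_plus"
    and "m \<ge> 1"
    and "depth_at_most G m f_plus"
  shows "(\<forall>s \<beta>. Im s > 3/2 + norm \<beta> * sup_norm_plus G f_plus / ln (real q) \<longrightarrow>
            (s, \<beta>) \<in> abs_conv_domain G q f \<and>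
            dyn_det G q f s \<beta> =
              op_det (F_space G m)
                (\<lambda>\<phi>. \<phi> - fun_scale (of_nat q powr (1/2 + \<i> * s))
                           (transfer_op G (\<lambda>p. exp (- \<beta> * f_plus p)) \<phi>))) \<and>
         (\<exists>D. holomorphic2_on D UNIV \<and>
              (\<forall>(s, \<beta>) \<in> abs_conv_domain G q f. D (s, \<beta>) = dyn_det G q f s \<beta>))"
proof -
  interpret pair_graph G by fact
  have "prefix_word m ` paths_plus G \<subseteq> {xs. set xs \<subseteq> parcs G \<and> length xs = m}"
    by (auto simp: prefix_word_def paths_plus_def)
  hence "finite (prefix_word m ` paths_plus G)"
    using finite_lists_length_eq[OF pair_finite_arcs] finite_subset by blast
  then obtain ws where ws: "distinct ws" "set ws = prefix_word m ` paths_plus G"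
    using finite_distinct_list by metis
  interpret prefix_words G m ws
    by unfold_locales (use assms(8) ws in auto)
  \<comment> \<open>The witness for the continuation: the determinant in the cylinder basis, which
    is fixed while \<open>(s, \<beta>)\<close> varies over the whole space.\<close>
  let ?D = "\<lambda>(s, \<beta>). Determinant.det (1\<^sub>m (length ws) -
    (of_nat q powr (1/2 + \<i> * s)) \<cdot>\<^sub>m sample_matrix (transfer_op G (\<lambda>p. exp (- \<beta> * f_plus p))))"
  have D: "dyn_det G q f s \<beta> = ?D (s, \<beta>)" if "(s, \<beta>) \<in> abs_conv_domain G q f" for s \<beta>
    using dyn_det_eq_det[OF assms(7,9) that] by simp
  have op: "op_det (F_space G m) (\<lambda>\<phi>. \<phi> - fun_scale z (transfer_op G (\<lambda>p. exp (- \<beta> * f_plus p)) \<phi>)) =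
      Determinant.det (1\<^sub>m (length ws) - z \<cdot>\<^sub>m sample_matrix (transfer_op G (\<lambda>p. exp (- \<beta> * f_plus p))))"
    for z \<beta>
    using transfer_op_F_space[OF fin m depth_at_most_exp[OF assms(9)]]
    by (intro op_det_id_minus_scale linear_transfer_op) blast
  show ?thesis
  proof (intro conjI allI impI exI[of _ ?D])
    fix s \<beta> :: complex assume "Im s > 3/2 + norm \<beta> * sup_norm_plus G f_plus / ln (real q)"
    thus conv: "(s, \<beta>) \<in> abs_conv_domain G q f"
      by (rule abs_conv_domainI[OF assms(7,9,1,4)])
    show "dyn_det G q f s \<beta> = op_det (F_space G m)
        (\<lambda>\<phi>. \<phi> - fun_scale (of_nat q powr (1/2 + \<i> * s)) (transfer_op G (\<lambda>p. exp (- \<beta> * f_plus p)) \<phi>))"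
      unfolding op using D[OF conv] by simp
  next
    show "holomorphic2_on ?D UNIV" by (rule holomorphic2_on_det_transfer_op[OF assms(1)])
    show "\<forall>(s, \<beta>) \<in> abs_conv_domain G q f. ?D (s, \<beta>) = dyn_det G q f s \<beta>"
      using D by auto
  qed
qed

end
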